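(* There exist universal constants $\rho_2\simeq 0.110549$ and $\beta_2\simeq 0.091287$ such that the following holds. Let $g:D(0,1)\to\mathbb{C}$ be an injective analytic function with $g(0)=0$ and $g'(0)=1$, and let $f=g^{-1}$ be its inverse (defined on $g(D(0,1))$). Then $g(D(0,\beta_2))\subset D(0,\rho_2)$, and if $z\in D(0,\rho_2)$, then for any $\epsilon\in(0,1/8)$ and any integer $$k\geq 3+\log_2|\log_2\epsilon|,$$ the iterate $N_f^k(z)$ belongs to $D(0,\epsilon)$. If $\epsilon>1/8$, then $z$ is already in $D(0,\epsilon)$.
   Context: $D(z,r)=\{z'\in\mathbb{C}:|z'-z|<r\}$. The Newton map of $f$ is $N_f(z)=z-f(z)/f'(z)$, defined on $g(D(0,1))$, and $N_f^k$ is its $k$-fold composition. "Universal" means independent of $g$; $\simeq$ gives the decimal value of the constant to the displayed accuracy. *)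

theory Defs
  imports "HOL-Complex_Analysis.Complex_Analysis"
begin

definition newton_map :: "(complex \<Rightarrow> complex) \<Rightarrow> complex \<Rightarrow> complex" where
  "newton_map f z = z - f z / deriv f z"

text \<open>
  The Newton map is only meaningful on the domain \<open>S\<close> of \<open>f\<close>, so its \<open>k\<close>-fold composition is a
  partial function: it is defined at \<open>z\<close> exactly when \<open>z\<close> and the first \<open>k - 1\<close> iterates lie
  in \<open>S\<close>. Outside \<open>S\<close> the total function \<^const>\<open>newton_map\<close> takes arbitrary values.
\<close>

definition newton_iterate_defined ::
    "complex set \<Rightarrow> (complex \<Rightarrow> complex) \<Rightarrow> nat \<Rightarrow> complex \<Rightarrow> bool" where
  "newton_iterate_defined S f k z \<longleftrightarrow> (\<forall>j<k. (newton_map f ^^ j) z \<in> S)"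

end

theory Submission
  imports Defs
begin

text \<open>
  With \<open>z = g w\<close> the Newton map of \<open>f\<close> is \<open>g w - w g'(w)\<close>, and its derivative in \<open>w\<close> is
  \<open>- w g''(w)\<close>. The sharp Koebe bounds for \<open>g'\<close> and \<open>g''/g'\<close> give
  \<open>|N_f z| \<le> 2 r^2 / (1 - r)^3\<close> with \<open>r = |w|\<close>, and an integrated lower bound for \<open>g'\<close> gives
  \<open>r \<le> 10/7 |z|\<close> for \<open>|z| < \<rho>\<^sub>2\<close>; so \<open>|N_f z| \<le> 6.7 |z|^2\<close>, which is quadratic convergence
  since \<open>6.7 \<rho>\<^sub>2 < 3/4\<close>. The inclusion \<open>g (D(0, \<beta>\<^sub>2)) \<subseteq> D(0, \<rho>\<^sub>2)\<close> is Koebe's growth theorem,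
  as \<open>\<rho>\<^sub>2\<close> exceeds \<open>\<beta>\<^sub>2 / (1 - \<beta>\<^sub>2)^2\<close> only slightly.

  All Koebe bounds come from \<open>|g''(0)| \<le> 4\<close>, and this from Gronwall's area theorem. The area is
  that of the image of an annulus under \<open>F \<zeta> = 1/\<zeta> + \<phi> \<zeta>\<close>. It is computed in the logarithmic
  coordinate \<open>\<zeta> = exp (x + i y)\<close>, where \<open>F\<close> becomes injective on a rectangle, and it is bounded above
  by the area of an ellipse containing \<open>F\<close> of the inner circle.
\<close>

section \<open>The area theorem\<close>

lemma circle_mean_value:
  fixes f :: "complex \<Rightarrow> complex"
  assumes "f holomorphic_on ball 0 R" "0 < r" "r < R"
  shows "((\<lambda>t. f (of_real r * cis t)) has_integral 2 * of_real pi * f 0) {0..2*pi}"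
proof -
  have sub: "cball (0::complex) r \<subseteq> ball 0 R" using assms by auto
  have "((\<lambda>u. f u / (u - 0)) has_contour_integral (2 * of_real pi * \<i> * f 0)) (circlepath 0 r)"
    using sub assms by (intro Cauchy_integral_circlepath)
      (auto intro!: holomorphic_on_imp_continuous_on intro: holomorphic_on_subset)
  then have "((\<lambda>t. f (of_real r * cis t) / (of_real r * cis t) * r * \<i> * cis t) has_integral
      (2 * of_real pi * \<i> * f 0)) {0..2*pi}"
    unfolding circlepath_def by (subst (asm) has_contour_integral_part_circlepath_iff) auto
  also have "(\<lambda>t. f (of_real r * cis t) / (of_real r * cis t) * r * \<i> * cis t) =
      (\<lambda>t. f (of_real r * cis t) * \<i>)"
    using assms by (auto simp: field_simps)
  \<comment> \<open>The factor \<open>-\<i>\<close> removes the \<open>\<i>\<close> left over from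
    the differential of the circle.\<close>
  finally have "((\<lambda>t. f (of_real r * cis t) * \<i> * (-\<i>)) has_integral
      (2 * of_real pi * \<i> * f 0) * (-\<i>)) {0..2*pi}"
    by (rule has_integral_mult_left)
  then show ?thesis by (simp add: algebra_simps)
qed

lemma circle_mean_value_Re:
  fixes f :: "complex \<Rightarrow> complex"
  assumes "f holomorphic_on ball 0 R" "0 < r" "r < R"
  shows "((\<lambda>t. Re (f (of_real r * cis t))) has_integral 2 * pi * Re (f 0)) {0..2*pi}"
  using has_integral_linear[OF circle_mean_value[OF assms] bounded_linear_Re]
  by (simp add: o_def)

text \<open>Expand \<open>|D - b|^2\<close> and use that it is nonnegative. The lower bound is
  affine in \<open>Re (D * cnj b)\<close>, hence harmonic for holomorphic \<open>D\<close>, so its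
  circle mean is explicit and can stand in for Parseval's identity.\<close>

lemma norm_square_ge_linearization:
  fixes D b :: complex
  shows "2 * Re (D * cnj b) - (norm b)\<^sup>2 \<le> (norm D)\<^sup>2"
proof -
  have "0 \<le> (norm (D - b))\<^sup>2" by simp
  also have "\<dots> = (norm D)\<^sup>2 - 2 * Re (D * cnj b) + (norm b)\<^sup>2"
    by (simp add: cmod_power2) (simp add: power2_eq_square algebra_simps)
  finally show ?thesis by simp
qed

text \<open>Factor out \<open>1 / \<zeta>\<close>. On a circle the cross term is a constant multiple
  of the real part of a function vanishing at \<open>0\<close>, so for holomorphic \<open>D\<close>
  it has mean zero.\<close>

lemma norm_square_pole_plus:
  fixes \<zeta> D :: complex
  assumes "\<zeta> \<noteq> 0"
  shows "(norm (- 1 / \<zeta> + \<zeta> * D))\<^sup>2 =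
    1 / (norm \<zeta>)\<^sup>2 - 2 / (norm \<zeta>)\<^sup>2 * Re (\<zeta>\<^sup>2 * D) + (norm \<zeta>)\<^sup>2 * (norm D)\<^sup>2"
proof -
  have "- 1 / \<zeta> + \<zeta> * D = (\<zeta>\<^sup>2 * D - 1) / \<zeta>"
    using assms by (simp add: field_simps power2_eq_square)
  then have "(norm (- 1 / \<zeta> + \<zeta> * D))\<^sup>2 = (norm (\<zeta>\<^sup>2 * D - 1))\<^sup>2 / (norm \<zeta>)\<^sup>2"
    by (simp add: norm_divide power_divide)
  also have "(norm (\<zeta>\<^sup>2 * D - 1))\<^sup>2 = (norm (\<zeta>\<^sup>2 * D))\<^sup>2 - 2 * Re (\<zeta>\<^sup>2 * D) + 1"
    unfolding cmod_power2 by (simp add: power2_eq_square algebra_simps)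
  also have "(norm (\<zeta>\<^sup>2 * D))\<^sup>2 = (norm \<zeta>)\<^sup>2 * ((norm \<zeta>)\<^sup>2 * (norm D)\<^sup>2)"
    by (simp add: norm_mult norm_power power_mult_distrib power2_eq_square)
  finally show ?thesis using assms by (simp add: field_simps)
qed

text \<open>For \<open>D\<close> the derivative of \<open>\<phi>\<close>, the integrand is
  \<open>|\<zeta> F' \<zeta>|^2\<close> with \<open>F \<zeta> = 1/\<zeta> + \<phi> \<zeta>\<close>.
  The cross term averages to zero, and the linearization of \<open>|D|^2\<close> at
  \<open>D 0\<close> has mean exactly \<open>|D 0|^2\<close>.\<close>

lemma circle_integral_norm_square_ge:
  assumes hol: "D holomorphic_on ball 0 1" and r: "0 < r" "r < 1"
    and int: "(\<lambda>t. (norm (- 1 / (of_real r * cis t) + of_real r * cis t * D (of_real r * cis t)))\<^sup>2)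
      integrable_on {0..2*pi}" (is "?K integrable_on _")
  shows "2 * pi * (1 / r\<^sup>2 + r\<^sup>2 * (norm (D 0))\<^sup>2) \<le> integral {0..2*pi} ?K"
proof -
  define z where "z t = of_real r * cis t" for t
  have nz: "z t \<noteq> 0" "norm (z t) = r" for t using r by (auto simp: z_def norm_mult)
  have h1: "(\<lambda>\<zeta>. \<zeta>\<^sup>2 * D \<zeta>) holomorphic_on ball 0 1" "(\<lambda>\<zeta>. D \<zeta> * cnj (D 0)) holomorphic_on ball 0 1"
    by (intro holomorphic_intros hol)+
  note I1 = circle_mean_value_Re[OF h1(1) r, folded z_def]
  note I2 = circle_mean_value_Re[OF h1(2) r, folded z_def]
  have c: "((\<lambda>t. 1 / r\<^sup>2) has_integral 2 * pi * (1 / r\<^sup>2)) {0..2*pi}"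
    "((\<lambda>t. (norm (D 0))\<^sup>2) has_integral 2 * pi * (norm (D 0))\<^sup>2) {0..2*pi}"
    using has_integral_const_real[of "1/r\<^sup>2" 0 "2*pi"] has_integral_const_real[of "(norm (D 0))\<^sup>2" 0 "2*pi"] by auto
  have "((\<lambda>t. 1 / r\<^sup>2 - 2 / r\<^sup>2 * Re ((z t)\<^sup>2 * D (z t)) +
         r\<^sup>2 * (2 * Re (D (z t) * cnj (D 0)) - (norm (D 0))\<^sup>2)) has_integral
       2 * pi * (1 / r\<^sup>2) - 2 / r\<^sup>2 * (2 * pi * Re (0\<^sup>2 * D 0)) +
         r\<^sup>2 * (2 * (2 * pi * Re (D 0 * cnj (D 0))) - 2 * pi * (norm (D 0))\<^sup>2)) {0..2*pi}"
    by (intro has_integral_add has_integral_diff has_integral_mult_right c I1 I2)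
  also have "2 * pi * (1 / r\<^sup>2) - 2 / r\<^sup>2 * (2 * pi * Re (0\<^sup>2 * D 0)) +
         r\<^sup>2 * (2 * (2 * pi * Re (D 0 * cnj (D 0))) - 2 * pi * (norm (D 0))\<^sup>2) =
         2 * pi * (1 / r\<^sup>2 + r\<^sup>2 * (norm (D 0))\<^sup>2)"
    by (simp add: complex_mult_cnj cmod_power2 algebra_simps)
  finally have L: "((\<lambda>t. 1 / r\<^sup>2 - 2 / r\<^sup>2 * Re ((z t)\<^sup>2 * D (z t)) +
         r\<^sup>2 * (2 * Re (D (z t) * cnj (D 0)) - (norm (D 0))\<^sup>2)) has_integral
         2 * pi * (1 / r\<^sup>2 + r\<^sup>2 * (norm (D 0))\<^sup>2)) {0..2*pi}" .
  show ?thesis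
  proof (rule has_integral_le[OF L integrable_integral[OF int]])
    fix t
    show "1 / r\<^sup>2 - 2 / r\<^sup>2 * Re ((z t)\<^sup>2 * D (z t)) +
         r\<^sup>2 * (2 * Re (D (z t) * cnj (D 0)) - (norm (D 0))\<^sup>2) \<le> ?K t"
      using norm_square_pole_plus[OF nz(1), of t "D (z t)"]
        mult_left_mono[OF norm_square_ge_linearization[of "D (z t)" "D 0"], of "r\<^sup>2"]
      by (simp add: nz(2)) (simp add: z_def)
  qed
qed

text \<open>\<open>K\<close> is the Jacobian of \<open>F\<close> in the logarithmic coordinate,
  where the chain rule for \<open>exp\<close> contributes the factor \<open>\<zeta>\<close>. Fubini
  reduces the claim to the circle bound at radius \<open>exp x\<close>, integrated over
  \<open>x\<close>.\<close>

lemma annulus_integral_norm_square_ge: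
  assumes hol: "D holomorphic_on ball 0 1" and s: "0 < s" "s < \<rho>" "\<rho> < 1"
  defines "K \<equiv> (\<lambda>(x, y). (norm (- 1 / exp (Complex x y) + exp (Complex x y) * D (exp (Complex x y))))\<^sup>2)"
  shows "pi * (1 / s\<^sup>2 - 1 / \<rho>\<^sup>2 + (norm (D 0))\<^sup>2 * (\<rho>\<^sup>2 - s\<^sup>2)) \<le>
    integral (cbox (ln s, 0) (ln \<rho>, 2*pi)) K"
proof -
  have cC: "continuous_on UNIV (\<lambda>p::real\<times>real. Complex (fst p) (snd p))"
    unfolding Complex_eq by (intro continuous_intros)
  have cE: "continuous_on (cbox (ln s, 0) (ln \<rho>, 2*pi)) (\<lambda>p::real\<times>real. exp (Complex (fst p) (snd p)))"
    by (intro continuous_intros continuous_on_subset[OF cC]) auto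
  have lr: "ln \<rho> < 0" using s by simp
  have "continuous_on (cbox (ln s, 0) (ln \<rho>, 2*pi)) (\<lambda>p::real\<times>real. D (exp (Complex (fst p) (snd p))))"
    using lr by (intro continuous_on_compose2[OF holomorphic_on_imp_continuous_on[OF hol] cE])
       (auto simp: cbox_Pair_eq)
  then have cK: "continuous_on (cbox (ln s, 0) (ln \<rho>, 2*pi)) K"
    unfolding K_def case_prod_beta by (intro continuous_intros cE) auto
  have cKx: "continuous_on {0..2*pi} (\<lambda>y. K (x, y))" if "x \<in> {ln s..ln \<rho>}" for x
    using that by (intro continuous_on_compose2[OF cK]) (auto intro!: continuous_intros simp: cbox_Pair_eq)
  have eq: "exp (Complex x y) = of_real (exp x) * cis y" for x y
    by (simp add: exp_eq_polar)
  have inner: "2 * pi * (exp (-2*x) + exp (2*x) * (norm (D 0))\<^sup>2) \<le> integral {0..2*pi} (\<lambda>y. K (x, y))"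
    if x: "x \<in> {ln s..ln \<rho>}" for x
  proof -
    have "(exp x)\<^sup>2 = exp (2 * x)" "1 / (exp x)\<^sup>2 = exp (- 2 * x)"
      using exp_double[of x] exp_minus[of "2 * x"] by (simp_all add: field_simps)
    moreover have "2 * pi * (1 / (exp x)\<^sup>2 + (exp x)\<^sup>2 * (norm (D 0))\<^sup>2) \<le> integral {0..2*pi} (\<lambda>y. K (x, y))"
      using circle_integral_norm_square_ge[OF hol, of "exp x"] x lr
        integrable_continuous_interval[OF cKx[OF x]]
      unfolding K_def prod.case eq by simp
    ultimately show ?thesis by simp
  qed
  define \<Phi> where "\<Phi> x = pi * (- exp (-2*x) + exp (2*x) * (norm (D 0))\<^sup>2)" for x :: real
  have outer: "((\<lambda>x. 2 * pi * (exp (-2*x) + exp (2*x) * (norm (D 0))\<^sup>2)) has_integral \<Phi> (ln \<rho>) - \<Phi> (ln s)) {ln s..ln \<rho>}"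
  proof (rule fundamental_theorem_of_calculus)
    show "ln s \<le> ln \<rho>" using s by simp
    show "(\<Phi> has_vector_derivative 2 * pi * (exp (-2*x) + exp (2*x) * (norm (D 0))\<^sup>2)) (at x within {ln s..ln \<rho>})" for x
      unfolding \<Phi>_def has_real_derivative_iff_has_vector_derivative[symmetric]
      by (auto intro!: derivative_eq_intros simp: algebra_simps)
  qed
  have "integral (cbox (ln s, 0) (ln \<rho>, 2*pi)) K =
      integral {ln s..ln \<rho>} (\<lambda>x. integral {0..2*pi} (\<lambda>y. K (x, y)))"
    using integral_prod_continuous[OF cK] by simp
  moreover have "(\<lambda>x. integral {0..2*pi} (\<lambda>y. K (x, y))) integrable_on {ln s..ln \<rho>}"
    using integral_integrable_2dim[OF cK] by simp
  ultimately have "\<Phi> (ln \<rho>) - \<Phi> (ln s) \<le> integral (cbox (ln s, 0) (ln \<rho>, 2*pi)) K"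
    using has_integral_le[OF outer _ inner] by (metis integrable_integral)
  moreover have e: "exp (2 * ln u) = u\<^sup>2" "exp (-2 * ln u) = 1 / u\<^sup>2" if "u > 0" for u :: real
    using that exp_double[of "ln u"] exp_minus[of "2 * ln u"] by (simp_all add: field_simps)
  moreover have "\<Phi> (ln \<rho>) - \<Phi> (ln s) = pi * (1 / s\<^sup>2 - 1 / \<rho>\<^sup>2 + (norm (D 0))\<^sup>2 * (\<rho>\<^sup>2 - s\<^sup>2))"
    using s e[of s] e[of \<rho>] unfolding \<Phi>_def by (simp add: algebra_simps)
  ultimately show ?thesis by simp
qed

text \<open>
  If \<open>p = F \<zeta>\<^sub>0\<close> were outside \<open>E\<close>, injectivity would make \<open>1 / (F - p)\<close> holomorphic on \<open>|\<zeta>| \<le> s\<close> with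
  value \<open>0\<close> at \<open>0\<close>, while a separating line keeps it in an open half plane on the circle \<open>|\<zeta>| = s\<close>.
\<close>

lemma pole_function_image_in_convex:
  fixes \<phi> :: "complex \<Rightarrow> complex"
  defines "F \<equiv> (\<lambda>\<zeta>. 1 / \<zeta> + \<phi> \<zeta>)"
  assumes hol: "\<phi> holomorphic_on ball 0 1" and inj: "inj_on F (ball 0 1 - {0})"
    and E: "convex E" "closed E" and circ: "\<And>\<zeta>. norm \<zeta> = s \<Longrightarrow> F \<zeta> \<in> E"
    and s: "0 < s" "s < norm \<zeta>\<^sub>0" "norm \<zeta>\<^sub>0 < 1"
  shows "F \<zeta>\<^sub>0 \<in> E"
proof (rule ccontr)
  define p where "p = F \<zeta>\<^sub>0"
  assume "F \<zeta>\<^sub>0 \<notin> E"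
  then obtain a c where ac: "inner a p < c" "\<And>x. x \<in> E \<Longrightarrow> inner a x > c"
    using separating_hyperplane_closed_point[OF E, of p] unfolding p_def by blast
  have pos: "0 < Re (cnj a * (F \<zeta> - p))" if "norm \<zeta> = s" for \<zeta>
    using ac(1) ac(2)[OF circ[OF that]] by (simp add: inner_complex_def algebra_simps)
  define R where "R = norm \<zeta>\<^sub>0"
  \<comment> \<open>Away from \<open>0\<close>, a zero would mean
    \<open>F \<zeta> = F \<zeta>\<^sub>0\<close> with \<open>|\<zeta>| < |\<zeta>\<^sub>0|\<close>,
    against injectivity.\<close>
  have nz: "1 + \<zeta> * \<phi> \<zeta> - p * \<zeta> \<noteq> 0" if "\<zeta> \<in> ball 0 R" for \<zeta>
  proof (cases "\<zeta> = 0")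
    case False
    have "F \<zeta> \<noteq> p"
      using inj that False s unfolding inj_on_def p_def R_def by force
    moreover have "1 + \<zeta> * \<phi> \<zeta> - p * \<zeta> = \<zeta> * (F \<zeta> - p)"
      using False by (simp add: F_def field_simps)
    ultimately show ?thesis using False by simp
  qed auto
  have holR: "\<phi> holomorphic_on ball 0 R"
    using s by (intro holomorphic_on_subset[OF hol]) (auto simp: R_def)
  \<comment> \<open>Off \<open>0\<close> this is \<open>1 / (cnj a * (F \<zeta> - p))\<close>,
    written so that the pole of \<open>F\<close> becomes a zero of \<open>H\<close>. Inversion
    preserves the right half plane, so \<open>Re H\<close> is positive on the circle although its
    mean is \<open>Re (H 0) = 0\<close>.\<close>
  define H where "H \<zeta> = \<zeta> / (1 + \<zeta> * \<phi> \<zeta> - p * \<zeta>) / cnj a" for \<zeta>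
  have "a \<noteq> 0" using pos[of "of_real s"] s by auto
  then have "H holomorphic_on ball 0 R"
    unfolding H_def using nz by (intro holomorphic_intros holR) auto
  from circle_mean_value_Re[OF this s(1)] s
  have I0: "((\<lambda>t. Re (H (of_real s * cis t))) has_integral 0) (cbox 0 (2*pi))"
    by (simp add: R_def H_def)
  have Hpos: "0 < Re (H \<zeta>)" if "norm \<zeta> = s" for \<zeta>
  proof -
    have "\<zeta> \<noteq> 0" using that s by auto
    then have "\<zeta> / (1 + \<zeta> * \<phi> \<zeta> - p * \<zeta>) = 1 / (F \<zeta> - p)"
      by (simp add: F_def divide_simps) (simp add: algebra_simps)
    then have "H \<zeta> = 1 / (cnj a * (F \<zeta> - p))" by (simp add: H_def)
    with pos[OF that] show ?thesis
      using Re_complex_div_gt_0[of 1 "cnj a * (F \<zeta> - p)"]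
      by (metis complex_cnj_mult complex_cnj_one mult_1 cnj.sel(1) complex_cnj_cnj)
  qed
  have "continuous_on (cbox 0 (2*pi)) (\<lambda>t. Re (H (of_real s * cis t)))"
    using s by (intro continuous_intros continuous_on_compose2[OF holomorphic_on_imp_continuous_on
       [OF \<open>H holomorphic_on ball 0 R\<close>]]) (auto simp: norm_mult R_def)
  then have "Re (H (of_real s * cis 0)) = 0"
    using I0 Hpos s by (intro has_integral_0_cbox_imp_0[OF _ _ I0])
      (auto simp: norm_mult less_imp_le not_le[of pi 0])
  then show False using Hpos[of "of_real s * cis 0"] s by simp
qed

section \<open>The complex plane as \<open>real^2\<close> and areas of ellipses\<close>

text \<open>Determinants and the change of variables formula are used on \<open>real^2\<close>; this
  map and \<open>plane_of_cplx\<close> are the mutually inverse isometries that carry planar sets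
  and maps there.\<close>

definition cplx_of_plane :: "real^2 \<Rightarrow> complex" where
  "cplx_of_plane v = Complex (v$1) (v$2)"

definition plane_of_cplx :: "complex \<Rightarrow> real^2" where
  "plane_of_cplx z = vector [Re z, Im z]"

lemma cplx_of_plane_of_cplx [simp]: "cplx_of_plane (plane_of_cplx z) = z"
  by (simp add: cplx_of_plane_def plane_of_cplx_def)

lemma plane_of_cplx_of_plane [simp]: "plane_of_cplx (cplx_of_plane v) = v"
  by (simp add: cplx_of_plane_def plane_of_cplx_def vec_eq_iff forall_2)

lemma plane_of_cplx_nth [simp]: "plane_of_cplx z $ 1 = Re z" "plane_of_cplx z $ 2 = Im z"
  by (simp_all add: plane_of_cplx_def)

lemma bounded_linear_plane_of_cplx: "bounded_linear plane_of_cplx"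
  by (rule linear_conv_bounded_linear[THEN iffD1], rule linearI)
     (auto simp: vec_eq_iff forall_2)

lemma bounded_linear_cplx_of_plane: "bounded_linear cplx_of_plane"
  by (rule linear_conv_bounded_linear[THEN iffD1], rule linearI)
     (auto simp: cplx_of_plane_def complex_eq_iff)

lemma inj_plane_of_cplx: "inj_on plane_of_cplx S"
  by (metis cplx_of_plane_of_cplx inj_on_inverseI)

lemma inj_cplx_of_plane: "inj_on cplx_of_plane S"
  by (metis plane_of_cplx_of_plane inj_on_inverseI)

lemma norm_plane_of_cplx [simp]: "norm (plane_of_cplx z) = norm z"
  by (simp add: norm_vec_def L2_set_def sum_2 cmod_def)

lemma plane_of_cplx_image_cball: "plane_of_cplx ` cball 0 R = cball 0 R"
proof -
  have "v \<in> plane_of_cplx ` cball 0 R" if "norm v \<le> R" for v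
    using that norm_plane_of_cplx[of "cplx_of_plane v"]
    by (intro image_eqI[of _ _ "cplx_of_plane v"]) auto
  then show ?thesis by auto
qed

text \<open>The matrix for \<open>c = x + i y\<close> has rows \<open>(x, -y)\<close> and
  \<open>(y, x)\<close>. Hence the Jacobian of a holomorphic map is the squared modulus of its
  derivative.\<close>

lemma det_complex_mult:
  "det (matrix (\<lambda>v. plane_of_cplx (c * cplx_of_plane v))) = (norm c)\<^sup>2"
  by (simp add: det_2 matrix_def axis_def cplx_of_plane_def cmod_power2)
     (simp add: power2_eq_square)

text \<open>The matrix for \<open>\<beta> = u + i v\<close> has rows \<open>(1 + u, v)\<close> and
  \<open>(v, 1 - u)\<close>.\<close>

lemma det_plus_mult_cnj:
  "det (matrix (\<lambda>v. plane_of_cplx (cplx_of_plane v + \<beta> * cnj (cplx_of_plane v)))) = 1 - (norm \<beta>)\<^sup>2"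
  by (simp add: det_2 matrix_def axis_def cplx_of_plane_def cmod_power2)
     (simp add: power2_eq_square algebra_simps)

text \<open>Links the change of variables formula on \<open>real^2\<close> with Fubini on pairs of
  reals: the coordinate bijection \<open>G\<close> maps boxes to boxes of equal content.\<close>

lemma has_integral_plane_prod:
  fixes g :: "real^2 \<Rightarrow> real" and a b :: "real^2"
  assumes "(g has_integral I) (cbox a b)"
  shows "((\<lambda>(x, y). g (vector [x, y])) has_integral I) (cbox (a$1, a$2) (b$1, b$2))"
proof -
  define G where "G = (\<lambda>(x, y). vector [x, y] :: real^2)"
  define h where "h = (\<lambda>v::real^2. (v$1, v$2))"
  have hG: "h (G p) = p" "G (h v) = v" for p v
    by (auto simp: h_def G_def vec_eq_iff forall_2 split: prod.splits)
  have himg: "h ` cbox u v = cbox (u$1, u$2) (v$1, v$2)" for u v :: "real^2"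
  proof -
    have "p \<in> h ` cbox u v" if "p \<in> cbox (u$1, u$2) (v$1, v$2)" for p
      using that by (intro image_eqI[of _ _ "G p"])
        (auto simp: h_def G_def mem_box_cart forall_2 cbox_Pair_eq split: prod.splits)
    then show ?thesis
      by (auto simp: h_def mem_box_cart forall_2 cbox_Pair_eq)
  qed
  have Gimg: "G ` cbox p q = cbox (G p) (G q)" for p q
  proof -
    have "cbox p q = h ` cbox (G p) (G q)"
      by (auto simp: himg G_def split: prod.splits)
    then show ?thesis by (simp add: image_image hG)
  qed
  have "bounded_linear G"
    by (rule linear_conv_bounded_linear[THEN iffD1], rule linearI)
       (auto simp: G_def vec_eq_iff forall_2)
  then have contG: "continuous (at x) G" for x
    by (simp add: linear_continuous_at)
  have cont: "measure lborel (G ` cbox p q) = 1 * measure lborel (cbox p q)" for p q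
  proof -
    have ex2: "(\<exists>i::2. P i) \<longleftrightarrow> P 1 \<or> P 2" for P by (metis exhaust_2)
    obtain a b c d where pq: "p = (a, b)" "q = (c, d)" by (metis surj_pair)
    show ?thesis
      unfolding Gimg
      by (auto simp: pq G_def content_cbox_if_cart content_Pair UNIV_2 interval_eq_empty_cart ex2 content_real_if)
  qed
  have "((\<lambda>p. g (G p)) has_integral (1/1) *\<^sub>R I) (h ` cbox a b)"
    using Gimg himg by (intro has_integral_twiddle[OF _ hG contG _ _ cont assms]) auto
  then show ?thesis unfolding himg by (simp add: G_def case_prod_unfold)
qed

text \<open>The set is the image of a disc under a real-linear map whose determinant has modulus at
  most \<open>1\<close>.\<close>

lemma ellipse_measure_le:
  assumes "norm \<beta> \<le> 1" "0 \<le> R"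
  shows "plane_of_cplx ` (\<lambda>W. W + \<beta> * cnj W) ` cball 0 R \<in> lmeasurable"
    and "measure lebesgue (plane_of_cplx ` (\<lambda>W. W + \<beta> * cnj W) ` cball 0 R) \<le> pi * R\<^sup>2"
proof -
  define L where "L v = plane_of_cplx (cplx_of_plane v + \<beta> * cnj (cplx_of_plane v))" for v
  have lin: "linear L"
    unfolding L_def
    by (intro bounded_linear.linear bounded_linear_compose[OF bounded_linear_plane_of_cplx]
      bounded_linear_add bounded_linear_cplx_of_plane
      bounded_linear_const_mult bounded_linear_compose[OF bounded_linear_cnj])
  have eq: "plane_of_cplx ` (\<lambda>W. W + \<beta> * cnj W) ` cball 0 R = L ` cball 0 R"
    by (subst plane_of_cplx_image_cball[symmetric]) (simp add: image_image L_def)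
  show "plane_of_cplx ` (\<lambda>W. W + \<beta> * cnj W) ` cball 0 R \<in> lmeasurable"
    unfolding eq by (intro measurable_linear_image lin lmeasurable_cball)
  have "measure lebesgue (L ` cball 0 R) = \<bar>1 - (norm \<beta>)\<^sup>2\<bar> * measure lebesgue (cball 0 R :: (real^2) set)"
    using det_plus_mult_cnj[of \<beta>] measure_linear_image[OF lin lmeasurable_cball[of 0 R]]
    by (simp add: L_def[abs_def])
  also have "measure lebesgue (cball 0 R :: (real^2) set) = pi * R\<^sup>2"
    using content_cball[OF assms(2), of "0 :: real^2"] by (simp add: unit_ball_vol_2)
  also have "\<bar>1 - (norm \<beta>)\<^sup>2\<bar> * (pi * R\<^sup>2) \<le> 1 * (pi * R\<^sup>2)"
    using assms by (intro mult_right_mono) (auto simp: power_le_one_iff abs_square_le_1 abs_le_iff power_le_one intro: order_trans[of _ 0])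
  finally show "measure lebesgue (plane_of_cplx ` (\<lambda>W. W + \<beta> * cnj W) ` cball 0 R) \<le> pi * R\<^sup>2"
    unfolding eq by simp
qed

text \<open>Composing \<open>W + \<beta> * cnj W\<close> with \<open>W - \<beta> * cnj W\<close>
  multiplies by \<open>1 - |\<beta>|^2\<close>, which gives the inverse. For the norm bound,
  \<open>|\<beta> * cnj \<delta>| \<le> |\<delta>| / 2\<close> is absorbed on the left.\<close>

lemma plus_mult_cnj_surj:
  assumes "norm \<beta> \<le> 1/2"
  obtains \<delta> where "\<delta> + \<beta> * cnj \<delta> = e" "norm \<delta> \<le> 2 * norm e"
proof
  define n where "n = 1 - (norm \<beta>)\<^sup>2"
  have n: "n > 0" using assms power_mono[OF assms, of 2] by (auto simp: n_def power2_eq_square)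
  define \<delta> where "\<delta> = (e - \<beta> * cnj e) / of_real n"
  have "(\<delta> + \<beta> * cnj \<delta>) = (e - \<beta> * cnj \<beta> * e) / of_real n"
    using n by (simp add: \<delta>_def field_simps)
  also have "e - \<beta> * cnj \<beta> * e = e * of_real n"
    by (simp add: n_def complex_norm_square algebra_simps flip: of_real_power)
  finally show *: "\<delta> + \<beta> * cnj \<delta> = e" using n by simp
  have "norm \<delta> - norm (\<beta> * cnj \<delta>) \<le> norm e"
    using norm_triangle_ineq4[of e "\<beta> * cnj \<delta>"] *[symmetric] by simp
  moreover have "norm (\<beta> * cnj \<delta>) \<le> 1/2 * norm \<delta>"
    using mult_right_mono[OF assms, of "norm \<delta>"] by (simp add: norm_mult)
  ultimately show "norm \<delta> \<le> 2 * norm e" by linarith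
qed

text \<open>
  On \<open>|\<zeta>| = s\<close> the linear term \<open>b \<zeta>\<close> equals \<open>b s^2 cnj W\<close> with \<open>W = 1/\<zeta>\<close>, so it is absorbed in a
  real-linear map of determinant at most 1; a disc would miss the sharp constant by a term in \<open>b\<close>.
\<close>

lemma pole_function_circle_in_ellipse:
  fixes \<phi> :: "complex \<Rightarrow> complex"
  assumes b: "norm b * s\<^sup>2 \<le> 1/2" and M: "norm (\<phi> \<zeta> - b * \<zeta>) \<le> M * s\<^sup>2"
    and \<zeta>: "norm \<zeta> = s" "0 < s"
  shows "1 / \<zeta> + \<phi> \<zeta> \<in> (\<lambda>W. W + (b * of_real (s\<^sup>2)) * cnj W) ` cball 0 (1 / s + 2 * M * s\<^sup>2)"
proof -
  obtain \<delta> where d: "\<delta> + (b * of_real (s\<^sup>2)) * cnj \<delta> = \<phi> \<zeta> - b * \<zeta>" "norm \<delta> \<le> 2 * norm (\<phi> \<zeta> - b * \<zeta>)"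
    using plus_mult_cnj_surj[of "b * of_real (s\<^sup>2)" "\<phi> \<zeta> - b * \<zeta>"] b \<zeta>
    by (auto simp: norm_mult norm_power)
  have "\<zeta> \<noteq> 0" using \<zeta> by auto
  have "of_real (s\<^sup>2) = \<zeta> * cnj \<zeta>" using \<zeta>(1) complex_norm_square by metis
  then have "(b * of_real (s\<^sup>2)) * cnj (1 / \<zeta>) = b * \<zeta>" using \<open>\<zeta> \<noteq> 0\<close> by simp
  then have "1 / \<zeta> + \<phi> \<zeta> = (1 / \<zeta> + \<delta>) + (b * of_real (s\<^sup>2)) * cnj (1 / \<zeta> + \<delta>)"
    using d(1) by (simp add: algebra_simps)
  moreover have "norm (1 / \<zeta> + \<delta>) \<le> 1 / s + 2 * M * s\<^sup>2"
    using norm_triangle_ineq[of "1/\<zeta>" \<delta>] d(2) M \<zeta> by (simp add: norm_divide)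
  ultimately show ?thesis by (intro image_eqI[of _ _ "1 / \<zeta> + \<delta>"]) auto
qed

section \<open>The area theorem in the limit of a small inner radius\<close>

text \<open>The image of the slit annulus \<open>s < |\<zeta>| < \<rho>\<close> has area at least
  \<open>pi\<close> times the left side, by the integral of the Jacobian, and at most
  \<open>pi\<close> times the right side, since it lies in the ellipse.\<close>

lemma pole_function_area_step:
  fixes \<phi> :: "complex \<Rightarrow> complex"
  assumes hol: "\<phi> holomorphic_on ball 0 1" and inj: "inj_on (\<lambda>\<zeta>. 1 / \<zeta> + \<phi> \<zeta>) (ball 0 1 - {0})"
    and s: "0 < s" "s < \<rho>" "\<rho> < 1" and b: "b = deriv \<phi> 0" "norm b * s\<^sup>2 \<le> 1/2"
    and M: "\<And>\<zeta>. norm \<zeta> = s \<Longrightarrow> norm (\<phi> \<zeta> - b * \<zeta>) \<le> M * s\<^sup>2" and "0 \<le> M"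
  shows "1 / s\<^sup>2 - 1 / \<rho>\<^sup>2 + (norm b)\<^sup>2 * (\<rho>\<^sup>2 - s\<^sup>2) \<le> (1 / s + 2 * M * s\<^sup>2)\<^sup>2"
proof -
  define D where "D = deriv \<phi>"
  define R where "R = 1 / s + 2 * M * s\<^sup>2"
  define \<beta> where "\<beta> = b * of_real (s\<^sup>2)"
  define E where "E = (\<lambda>W. W + \<beta> * cnj W) ` cball 0 R"
  define F where "F \<zeta> = 1 / \<zeta> + \<phi> \<zeta>" for \<zeta>
  define J where "J \<zeta> = - 1 / \<zeta> + \<zeta> * D \<zeta>" for \<zeta>
  \<comment> \<open>Under \<open>exp\<close> the open rectangle becomes the annulus slit along the
    positive real axis; its height \<open>2 * pi\<close> is the largest for which \<open>exp\<close>
    stays injective.\<close>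
  define lo hi where "lo = plane_of_cplx (Complex (ln s) 0)" "hi = plane_of_cplx (Complex (ln \<rho>) (2 * pi))"
  define f where "f v = plane_of_cplx (F (exp (cplx_of_plane v)))" for v
  define f' where "f' v = (\<lambda>h. plane_of_cplx (J (exp (cplx_of_plane v)) * cplx_of_plane h))" for v
  have holD: "D holomorphic_on ball 0 1" unfolding D_def by (intro holomorphic_deriv hol) auto
  have R: "R \<ge> 0" using s \<open>0 \<le> M\<close> by (simp add: R_def)
  have beta: "norm \<beta> \<le> 1" using b(2) s by (simp add: \<beta>_def norm_mult norm_power)
  have linT: "linear (\<lambda>W. W + \<beta> * cnj W)"
    by (intro bounded_linear.linear bounded_linear_add bounded_linear_ident
      bounded_linear_const_mult bounded_linear_compose[OF bounded_linear_cnj])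
  have E: "convex E" "closed E"
    unfolding E_def using linT
    by (auto intro!: convex_linear_image compact_imp_closed compact_continuous_image linear_continuous_on
      simp: linear_conv_bounded_linear)
  have norm_exp: "s < norm (exp (cplx_of_plane v))" "norm (exp (cplx_of_plane v)) < 1"
    if "v \<in> box lo hi" for v
  proof -
    have "ln s < v$1" "v$1 < ln \<rho>" using that by (auto simp: lo_hi_def mem_box_cart forall_2)
    then have "s < exp (v$1)" "exp (v$1) < \<rho>" using s
      by (metis exp_less_cancel_iff exp_ln, metis exp_less_cancel_iff exp_ln order.strict_trans)
    moreover from this s have "exp (v$1) < 1" by linarith
    ultimately show "s < norm (exp (cplx_of_plane v))" "norm (exp (cplx_of_plane v)) < 1"
      by (auto simp: cplx_of_plane_def)
  qed
  have fE: "f ` box lo hi \<subseteq> plane_of_cplx ` E"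
  proof (clarsimp simp: f_def)
    fix v assume v: "v \<in> box lo hi"
    have "1 / exp (cplx_of_plane v) + \<phi> (exp (cplx_of_plane v)) \<in> E"
    proof (rule pole_function_image_in_convex[OF hol inj E _ s(1) norm_exp[OF v]])
      fix \<zeta> :: complex assume z: "norm \<zeta> = s"
      show "1 / \<zeta> + \<phi> \<zeta> \<in> E"
        unfolding E_def \<beta>_def R_def by (rule pole_function_circle_in_ellipse[where \<phi> = \<phi>, OF b(2) M[OF z] z s(1)])
    qed
    then show "plane_of_cplx (F (exp (cplx_of_plane v))) \<in> plane_of_cplx ` E" by (simp add: F_def)
  qed
  have der: "(f has_derivative f' v) (at v within box lo hi)" if v: "v \<in> box lo hi" for v
  proof -
    let ?e = "exp (cplx_of_plane v)"
    have "(\<phi> has_field_derivative D ?e) (at ?e)"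
      using norm_exp[OF v] hol unfolding D_def by (intro holomorphic_derivI[of _ "ball 0 1"]) auto
    then have "((\<lambda>\<tau>. F (exp \<tau>)) has_field_derivative J ?e) (at (cplx_of_plane v))"
      unfolding F_def J_def
      by (auto intro!: derivative_eq_intros DERIV_chain2[of \<phi>] simp: field_simps power2_eq_square)
    then have "((\<lambda>\<tau>. F (exp \<tau>)) has_derivative (*) (J ?e)) (at (cplx_of_plane v))"
      by (simp add: has_field_derivative_def)
    from bounded_linear.has_derivative[OF bounded_linear_plane_of_cplx
        has_derivative_compose[OF bounded_linear_imp_has_derivative[OF bounded_linear_cplx_of_plane] this]]
    have "(f has_derivative f' v) (at v)" unfolding f_def f'_def .
    then show ?thesis by (rule has_derivative_at_withinI)
  qed
  have injf: "inj_on f (box lo hi)"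
  proof (rule inj_onI)
    fix u v assume uv: "u \<in> box lo hi" "v \<in> box lo hi" "f u = f v"
    then have "F (exp (cplx_of_plane u)) = F (exp (cplx_of_plane v))"
      unfolding f_def using inj_plane_of_cplx[of UNIV] by (meson UNIV_I inj_onD)
    then have "exp (cplx_of_plane u) = exp (cplx_of_plane v)"
      using inj_onD[OF inj, of "exp (cplx_of_plane u)" "exp (cplx_of_plane v)"] norm_exp[OF uv(1)] norm_exp[OF uv(2)]
      by (auto simp: F_def)
    moreover have "\<bar>Im (cplx_of_plane u) - Im (cplx_of_plane v)\<bar> < 2 * pi"
      using uv by (auto simp: lo_hi_def mem_box_cart forall_2 cplx_of_plane_def)
    ultimately have "cplx_of_plane u = cplx_of_plane v"
      using complex_eqI exp_complex_eqI by blast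
    then show "u = v" using inj_cplx_of_plane[of UNIV] by (meson UNIV_I inj_onD)
  qed
  define K where "K v = (norm (J (exp (cplx_of_plane v))))\<^sup>2" for v
  have detK: "\<bar>det (matrix (f' v))\<bar> = K v" for v
    unfolding f'_def K_def by (simp add: det_complex_mult)
  \<comment> \<open>Continuity of \<open>K\<close> is needed on the closed rectangle to get
    integrability, while \<open>f\<close> is injective only on the open one; the boundary does not
    change the integral.\<close>
  have norm_exp_le: "norm (exp (cplx_of_plane v)) < 1" if "v \<in> cbox lo hi" for v
  proof -
    have "v$1 \<le> ln \<rho>" using that by (auto simp: lo_hi_def mem_box_cart forall_2)
    also have "\<dots> < 0" using s by simp
    finally show ?thesis by (simp add: cplx_of_plane_def)
  qed
  have cE: "continuous_on (cbox lo hi) (\<lambda>v. exp (cplx_of_plane v))"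
    by (intro continuous_intros linear_continuous_on bounded_linear_cplx_of_plane)
  have "continuous_on (cbox lo hi) (\<lambda>v. D (exp (cplx_of_plane v)))"
    using norm_exp_le by (intro continuous_on_compose2[OF holomorphic_on_imp_continuous_on[OF holD] cE]) auto
  then have "continuous_on (cbox lo hi) K"
    unfolding K_def J_def by (intro continuous_intros cE) auto
  then have Kint: "K integrable_on cbox lo hi" by (rule integrable_continuous)
  have meas: "measure lebesgue (f ` box lo hi) = integral (box lo hi) K"
    using measure_differentiable_image_eq[OF _ der injf] Kint
    by (simp add: detK integrable_on_open_interval)
  have fmeas: "f ` box lo hi \<in> lmeasurable"
    using measurable_differentiable_image_eq[OF _ der injf] Kint
    by (simp add: detK integrable_on_open_interval)
  have "measure lebesgue (f ` box lo hi) \<le> measure lebesgue (plane_of_cplx ` E)"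
    using fE fmeas ellipse_measure_le(1)[OF beta R] unfolding E_def by (intro measure_mono_fmeasurable) (auto intro: fmeasurableD)
  also have "\<dots> \<le> pi * R\<^sup>2"
    unfolding E_def by (rule ellipse_measure_le(2)[OF beta R])
  finally have up: "integral (cbox lo hi) K \<le> pi * R\<^sup>2"
    by (simp add: meas integral_open_interval)
  have "((\<lambda>(x, y). K (vector [x, y])) has_integral integral (cbox lo hi) K) (cbox (lo$1, lo$2) (hi$1, hi$2))"
    by (intro has_integral_plane_prod integrable_integral Kint)
  moreover have "(\<lambda>(x, y). K (vector [x, y])) = (\<lambda>(x, y). (norm (- 1 / exp (Complex x y) + exp (Complex x y) * D (exp (Complex x y))))\<^sup>2)"
    by (simp add: K_def J_def cplx_of_plane_def)
  ultimately have "pi * (1 / s\<^sup>2 - 1 / \<rho>\<^sup>2 + (norm (D 0))\<^sup>2 * (\<rho>\<^sup>2 - s\<^sup>2)) \<le> integral (cbox lo hi) K"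
    using annulus_integral_norm_square_ge[OF holD s] by (simp add: lo_hi_def integral_unique)
  with up have "pi * (1 / s\<^sup>2 - 1 / \<rho>\<^sup>2 + (norm b)\<^sup>2 * (\<rho>\<^sup>2 - s\<^sup>2)) \<le> pi * R\<^sup>2"
    unfolding b(1) D_def by (rule order_trans[rotated])
  then show ?thesis by (simp add: R_def)
qed

text \<open>Removable singularity of the difference quotient. The factorization holds for every
  \<open>z\<close>, also outside \<open>S\<close>, because the witness is the quotient itself;
  iteration yields Taylor expansions with holomorphic remainder.\<close>

lemma holomorphic_difference_quotient:
  fixes f :: "complex \<Rightarrow> complex"
  assumes "f holomorphic_on S" "open S" "a \<in> S"
  shows "\<exists>g. g holomorphic_on S \<and> (\<forall>z. f z = f a + (z - a) * g z) \<and> g a = deriv f a"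
proof (intro exI conjI)
  show "(\<lambda>z. if z = a then deriv f a else (f z - f a) / (z - a)) holomorphic_on S"
    using assms by (intro pole_lemma) (auto simp: interior_open)
qed auto

lemma zero_in_unit_ball: "(0::complex) \<in> ball 0 1"
  by simp

theorem area_theorem_first_coeff:
  fixes \<phi> :: "complex \<Rightarrow> complex"
  assumes hol: "\<phi> holomorphic_on ball 0 1" and inj: "inj_on (\<lambda>\<zeta>. 1 / \<zeta> + \<phi> \<zeta>) (ball 0 1 - {0})"
  shows "norm (deriv \<phi> 0) \<le> 1"
proof -
  define b where "b = deriv \<phi> 0"
  \<comment> \<open>Dropping the constant term keeps injectivity and makes the deviation from
    \<open>b * \<zeta>\<close> second order, as the ellipse estimate requires.\<close>
  define \<psi> where "\<psi> \<zeta> = \<phi> \<zeta> - \<phi> 0" for \<zeta>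
  have hol': "\<psi> holomorphic_on ball 0 1" unfolding \<psi>_def by (intro holomorphic_intros hol)
  have inj': "inj_on (\<lambda>\<zeta>. 1 / \<zeta> + \<psi> \<zeta>) (ball 0 1 - {0})"
    using inj unfolding inj_on_def \<psi>_def by (auto simp: algebra_simps)
  obtain h where h: "h holomorphic_on ball 0 1" "\<And>z. \<phi> z = \<phi> 0 + (z - 0) * h z" "h 0 = b"
    using holomorphic_difference_quotient[OF hol open_ball zero_in_unit_ball] unfolding b_def by blast
  obtain \<omega> where \<omega>: "\<omega> holomorphic_on ball 0 1" "\<And>z. h z = h 0 + (z - 0) * \<omega> z"
    using holomorphic_difference_quotient[OF h(1) open_ball zero_in_unit_ball] by blast
  have \<psi>_eq: "\<psi> z - b * z = z\<^sup>2 * \<omega> z" for z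
    using h(2)[of z] \<omega>(2)[of z] h(3) by (simp add: \<psi>_def power2_eq_square algebra_simps)
  have "deriv \<psi> 0 = b"
  proof (rule DERIV_imp_deriv)
    have "(\<phi> has_field_derivative b) (at 0)"
      unfolding b_def by (intro holomorphic_derivI[OF hol]) auto
    then show "(\<psi> has_field_derivative b) (at 0)"
      unfolding \<psi>_def by (auto intro!: derivative_eq_intros)
  qed
  have "bounded (\<omega> ` cball 0 (1/2))"
    by (intro compact_imp_bounded compact_continuous_image holomorphic_on_imp_continuous_on
      holomorphic_on_subset[OF \<omega>(1)]) auto
  then obtain M where M: "0 < M" "\<And>z. norm z \<le> 1/2 \<Longrightarrow> norm (\<omega> z) \<le> M"
    by (force simp: bounded_pos)
  \<comment> \<open>The terms \<open>1 / s^2\<close> on both sides cancel, and the rest converges as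
    \<open>s\<close> decreases to \<open>0\<close>.\<close>
  have bnd: "(norm b)\<^sup>2 * \<rho>\<^sup>2 \<le> 1 / \<rho>\<^sup>2" if \<rho>: "0 < \<rho>" "\<rho> < 1" for \<rho>
  proof -
    have "\<forall>\<^sub>F s in at_right 0. s < \<rho>"
      unfolding eventually_at_right_field using \<rho> by (intro exI[of _ \<rho>]) simp
    moreover have "\<forall>\<^sub>F s in at_right 0. s < (1/2::real)"
      unfolding eventually_at_right_field by (rule exI[of _ "1/2"]) simp
    moreover have "\<forall>\<^sub>F s in at_right 0. norm b * s\<^sup>2 < 1/2"
      by (intro order_tendstoD(2)[of _ "norm b * 0\<^sup>2"] tendsto_intros) auto
    moreover have "\<forall>\<^sub>F s::real in at_right 0. 0 < s" by (simp add: eventually_at_right_less)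
    ultimately have ev: "\<forall>\<^sub>F s in at_right 0. (norm b)\<^sup>2 * (\<rho>\<^sup>2 - s\<^sup>2) \<le> 1 / \<rho>\<^sup>2 + 4 * M * s + 4 * M\<^sup>2 * s ^ 4"
    proof eventually_elim
      case (elim s)
      have "1 / s\<^sup>2 - 1 / \<rho>\<^sup>2 + (norm b)\<^sup>2 * (\<rho>\<^sup>2 - s\<^sup>2) \<le> (1 / s + 2 * M * s\<^sup>2)\<^sup>2"
      proof (rule pole_function_area_step[OF hol' inj'])
        fix \<zeta> :: complex assume "norm \<zeta> = s"
        then show "norm (\<psi> \<zeta> - b * \<zeta>) \<le> M * s\<^sup>2"
          using M(2)[of \<zeta>] elim mult_left_mono[of "norm (\<omega> \<zeta>)" M "s\<^sup>2"]
          unfolding \<psi>_eq norm_mult norm_power by (simp add: mult.commute)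
      next
        show "norm b * s\<^sup>2 \<le> 1/2" "0 < s" "s < \<rho>" using elim by simp_all
        show "b = deriv \<psi> 0" "\<rho> < 1" "0 \<le> M"
          using \<open>deriv \<psi> 0 = b\<close> \<rho>(2) M(1) by simp_all
      qed
      also have "(1 / s + 2 * M * s\<^sup>2)\<^sup>2 = (1 / s)\<^sup>2 + 4 * M * (1 / s * s\<^sup>2) + 4 * M\<^sup>2 * (s\<^sup>2)\<^sup>2"
        unfolding power2_sum by (simp only: power_mult_distrib mult_ac) simp
      also have "1 / s * s\<^sup>2 = s" by (simp add: power2_eq_square)
      also have "(s\<^sup>2)\<^sup>2 = s ^ 4" by simp
      also have "(1 / s)\<^sup>2 = 1 / s\<^sup>2" by (simp add: power_divide)
      finally show ?case by simp
    qed
    have l: "((\<lambda>s. (norm b)\<^sup>2 * (\<rho>\<^sup>2 - s\<^sup>2)) \<longlongrightarrow> (norm b)\<^sup>2 * (\<rho>\<^sup>2 - 0\<^sup>2)) (at_right 0)"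
      by (intro tendsto_intros)
    have u: "((\<lambda>s. 1 / \<rho>\<^sup>2 + 4 * M * s + 4 * M\<^sup>2 * s ^ 4) \<longlongrightarrow> 1 / \<rho>\<^sup>2 + 4 * M * 0 + 4 * M\<^sup>2 * 0 ^ 4) (at_right 0)"
      by (intro tendsto_intros)
    have "(norm b)\<^sup>2 * (\<rho>\<^sup>2 - 0\<^sup>2) \<le> 1 / \<rho>\<^sup>2 + 4 * M * 0 + 4 * M\<^sup>2 * 0 ^ 4"
      by (rule tendsto_le[OF trivial_limit_at_right_real u l ev])
    then show ?thesis by simp
  qed
  have "norm b \<le> 1"
  proof (rule field_le_mult_one_interval)
    fix x :: real assume x: "0 < x" "x < 1"
    \<comment> \<open>With \<open>\<rho> = sqrt x\<close> the bound becomes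
      \<open>|b| * x \<le> 1\<close> for all \<open>x\<close> strictly between \<open>0\<close> and
      \<open>1\<close>.\<close>
    have "(norm b)\<^sup>2 * x \<le> 1 / x" using bnd[of "sqrt x"] x by simp
    then have "(x * norm b)\<^sup>2 \<le> 1" using x by (simp add: field_simps power2_eq_square)
    then show "x * norm b \<le> 1" using x by (simp add: abs_square_le_1)
  qed
  then show ?thesis by (simp add: b_def)
qed

section \<open>Bounds for univalent functions\<close>

text \<open>The area theorem is applied to \<open>1 / sqrt (g (\<zeta>^2)) = 1/\<zeta> + \<zeta> R (\<zeta>^2)\<close>, where \<open>R 0 = - g''(0) / 4\<close>.\<close>

theorem Bieberbach_second_coeff:
  fixes g :: "complex \<Rightarrow> complex"
  assumes hol: "g holomorphic_on ball 0 1" and inj: "inj_on g (ball 0 1)"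
    and g0: "g 0 = 0" "deriv g 0 = 1"
  shows "norm (deriv (deriv g) 0) \<le> 4"
proof -
  obtain G where G: "G holomorphic_on ball 0 1" "\<And>z. g z = g 0 + (z - 0) * G z" "G 0 = deriv g 0"
    using holomorphic_difference_quotient[OF hol open_ball zero_in_unit_ball] by blast
  from G(3) g0 have G0: "G 0 = 1" by simp
  obtain S where S: "S holomorphic_on ball 0 1" "\<And>z. G z = G 0 + (z - 0) * S z"
    using holomorphic_difference_quotient[OF G(1) open_ball zero_in_unit_ball] by blast
  have Gnz: "G z \<noteq> 0" if "z \<in> ball 0 1" for z
    using G(2)[of z] G0 inj_onD[OF inj, of z 0] that g0 by (cases "z = 0") auto
  obtain q where q: "q holomorphic_on ball 0 1" "\<And>z. z \<in> ball 0 1 \<Longrightarrow> G z = q z ^ 2"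
    using contractible_imp_holomorphic_sqrt[OF G(1) convex_imp_contractible[OF convex_ball] Gnz] by blast
  \<comment> \<open>The numerator \<open>q 0\<close>, a square root of \<open>1\<close>, normalizes
    the branch: \<open>P 0 = 1\<close> and \<open>P^2 * G = 1\<close>, so
    \<open>P (\<zeta>^2) / \<zeta>\<close> is a branch of
    \<open>1 / sqrt (g (\<zeta>^2))\<close>.\<close>
  define P where "P z = q 0 / q z" for z
  have q0: "q 0 ^ 2 = 1" using q(2)[of 0] G0 by simp
  have qnz: "q z \<noteq> 0" if "z \<in> ball 0 1" for z using Gnz[OF that] q(2)[OF that] by auto
  have holP: "P holomorphic_on ball 0 1" unfolding P_def using qnz by (intro holomorphic_intros q) auto
  have Pnz: "P z \<noteq> 0" if "z \<in> ball 0 1" for z using qnz[OF that] qnz[of 0] by (simp add: P_def)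
  have P0: "P 0 = 1" using qnz[of 0] by (simp add: P_def)
  have PG: "P z ^ 2 * G z = 1" if "z \<in> ball 0 1" for z
    using q(2)[OF that] qnz[OF that] q0 by (simp add: P_def power_divide)
  obtain R where R: "R holomorphic_on ball 0 1" "\<And>z. P z = P 0 + (z - 0) * R z"
    using holomorphic_difference_quotient[OF holP open_ball zero_in_unit_ball] by blast
  define \<phi> where "\<phi> \<zeta> = \<zeta> * R (\<zeta>\<^sup>2)" for \<zeta>
  have sq: "\<zeta>\<^sup>2 \<in> ball 0 1" if "\<zeta> \<in> ball 0 1" for \<zeta> :: complex
    using that by (auto simp: norm_power power_less_one_iff abs_square_less_1)
  have F: "1 / \<zeta> + \<phi> \<zeta> = P (\<zeta>\<^sup>2) / \<zeta>" if "\<zeta> \<noteq> 0" for \<zeta>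
    using that R(2)[of "\<zeta>\<^sup>2"] P0 by (simp add: \<phi>_def field_simps power2_eq_square)
  have Rsq: "(\<lambda>\<zeta>. R (\<zeta>\<^sup>2)) holomorphic_on ball 0 1"
    using sq by (intro holomorphic_on_compose_gen[OF _ R(1), unfolded o_def, of "\<lambda>\<zeta>. \<zeta>\<^sup>2"])
      (auto intro!: holomorphic_intros)
  have "norm (deriv \<phi> 0) \<le> 1"
  proof (rule area_theorem_first_coeff)
    show "\<phi> holomorphic_on ball 0 1"
      unfolding \<phi>_def by (intro holomorphic_intros Rsq)
    show "inj_on (\<lambda>\<zeta>. 1 / \<zeta> + \<phi> \<zeta>) (ball 0 1 - {0})"
    proof (rule inj_onI)
      fix \<zeta> \<eta> assume z: "\<zeta> \<in> ball 0 1 - {0}" "\<eta> \<in> ball 0 1 - {0}" and "1 / \<zeta> + \<phi> \<zeta> = 1 / \<eta> + \<phi> \<eta>"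
      then have eq: "P (\<zeta>\<^sup>2) / \<zeta> = P (\<eta>\<^sup>2) / \<eta>" by (simp add: F)
      have inv: "g (\<xi>\<^sup>2) = 1 / (P (\<xi>\<^sup>2) / \<xi>)\<^sup>2" if "\<xi> \<in> ball 0 1 - {0}" for \<xi>
        using PG[OF sq[of \<xi>]] Pnz[OF sq[of \<xi>]] that G(2)[of "\<xi>\<^sup>2"] g0
        by (simp add: power_divide field_simps)
      have "g (\<zeta>\<^sup>2) = g (\<eta>\<^sup>2)" using inv[OF z(1)] inv[OF z(2)] eq by simp
      then have "\<zeta>\<^sup>2 = \<eta>\<^sup>2" using inj_onD[OF inj] sq z by auto
      \<comment> \<open>\<open>\<zeta> = - \<eta>\<close> is excluded because
        \<open>P (\<zeta>^2) / \<zeta>\<close> is odd and nonzero.\<close>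
      then show "\<zeta> = \<eta>" using eq Pnz[OF sq[of \<eta>]] z by (auto simp: power2_eq_iff field_simps)
    qed
  qed
  moreover have "deriv \<phi> 0 = R 0"
  proof (rule DERIV_imp_deriv)
    have "((\<lambda>\<zeta>. R (\<zeta>\<^sup>2)) has_field_derivative deriv (\<lambda>\<zeta>. R (\<zeta>\<^sup>2)) 0) (at 0)"
      by (rule holomorphic_derivI[OF Rsq]) auto
    then show "(\<phi> has_field_derivative R 0) (at 0)"
      unfolding \<phi>_def by (auto intro!: derivative_eq_intros)
  qed
  \<comment> \<open>Derivative at \<open>0\<close> of the identity
    \<open>P^2 * G = 1\<close>.\<close>
  moreover have "2 * R 0 + S 0 = 0"
  proof -
    have R': "(R has_field_derivative deriv R 0) (at 0)" and S': "(S has_field_derivative deriv S 0) (at 0)"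
      by (rule holomorphic_derivI[OF R(1)] holomorphic_derivI[OF S(1)]; simp)+
    have "((\<lambda>z. (1 + z * R z)\<^sup>2 * (1 + z * S z)) has_field_derivative 2 * R 0 + S 0) (at 0)"
      by (rule derivative_eq_intros R' S' refl | simp)+
    moreover have "((\<lambda>z. (1 + z * R z)\<^sup>2 * (1 + z * S z)) has_field_derivative 0) (at 0)"
    proof (rule has_field_derivative_transform_within_open[OF DERIV_const[of 1]])
      show "1 = (1 + z * R z)\<^sup>2 * (1 + z * S z)" if "z \<in> ball 0 1" for z
        using PG[OF that] R(2)[of z] S(2)[of z] G0 P0 by simp
    qed auto
    ultimately show ?thesis by (rule DERIV_unique)
  qed
  moreover have "deriv (deriv g) 0 = 2 * S 0"
  proof (rule DERIV_imp_deriv)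
    have g': "deriv g z = 1 + 2 * z * S z + z\<^sup>2 * deriv S z" if z: "z \<in> ball 0 1" for z
    proof (rule DERIV_imp_deriv)
      have "g w = w + w\<^sup>2 * S w" for w
        using G(2)[of w] G0 S(2)[of w] g0 by (simp add: algebra_simps power2_eq_square)
      then have eq: "g = (\<lambda>z. z + z\<^sup>2 * S z)" by (rule ext)
      show "(g has_field_derivative 1 + 2 * z * S z + z\<^sup>2 * deriv S z) (at z)"
        unfolding eq by (rule derivative_eq_intros holomorphic_derivI[OF S(1) _ z] refl | simp add: algebra_simps)+
    qed
    have S': "(S has_field_derivative deriv S 0) (at 0)"
      by (rule holomorphic_derivI[OF S(1)]) auto
    have S'': "(deriv S has_field_derivative deriv (deriv S) 0) (at 0)"
      by (rule holomorphic_derivI[of _ "ball 0 1"]) (auto intro!: holomorphic_deriv S(1))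
    have "((\<lambda>z. 1 + 2 * z * S z + z\<^sup>2 * deriv S z) has_field_derivative 2 * S 0) (at 0)"
      by (rule derivative_eq_intros S' S'' refl | simp)+
    then show "(deriv g has_field_derivative 2 * S 0) (at 0)"
      by (rule has_field_derivative_transform_within_open[OF _ open_ball zero_in_unit_ball]) (rule g'[symmetric])
  qed
  ultimately have "deriv (deriv g) 0 = -4 * deriv \<phi> 0" "norm (deriv \<phi> 0) \<le> 1"
    by (simp_all add: add_eq_0_iff2)
  then show ?thesis by (simp add: norm_mult)
qed

section \<open>The quarter theorem and the bound on \<open>g'' / g'\<close>\<close>

definition schlicht :: "(complex \<Rightarrow> complex) \<Rightarrow> bool" where
  "schlicht g \<longleftrightarrow> g holomorphic_on ball 0 1 \<and> inj_on g (ball 0 1) \<and> g 0 = 0 \<and> deriv g 0 = 1"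

lemma schlicht_has_field_derivative:
  assumes "schlicht g" "z \<in> ball 0 1"
  shows "(g has_field_derivative deriv g z) (at z)"
    and "(deriv g has_field_derivative deriv (deriv g) z) (at z)"
  using assms by (auto simp: schlicht_def intro!: holomorphic_derivI[of _ "ball 0 1"] holomorphic_deriv)

lemma schlicht_deriv_nonzero:
  assumes "schlicht g" "z \<in> ball 0 1"
  shows "deriv g z \<noteq> 0"
  using assms holomorphic_injective_imp_regular[of g "ball 0 1"] unfolding schlicht_def by blast

text \<open>Compares \<open>g\<close> with the univalent function \<open>c g / (c - g)\<close>.\<close>

theorem Koebe_quarter:
  assumes g: "schlicht g" and c: "c \<notin> g ` ball 0 1"
  shows "1/4 \<le> norm c"
proof -
  have c0: "c \<noteq> 0" using g c by (force simp: schlicht_def)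
  have nz: "c - g z \<noteq> 0" if "z \<in> ball 0 1" for z using c that by auto
  note g' = schlicht_has_field_derivative[OF g]
  define k where "k z = c * g z / (c - g z)" for z
  have k': "deriv k z = c\<^sup>2 * deriv g z / (c - g z)\<^sup>2" if z: "z \<in> ball 0 1" for z
  proof (rule DERIV_imp_deriv)
    show "(k has_field_derivative c\<^sup>2 * deriv g z / (c - g z)\<^sup>2) (at z)"
      unfolding k_def using nz[OF z]
      by (auto intro!: derivative_eq_intros g' z simp: field_simps power2_eq_square)
  qed
  \<comment> \<open>Passing from \<open>g\<close> to \<open>k\<close> adds \<open>2 / c\<close> to
    the second derivative at \<open>0\<close>. Both second derivatives have modulus at most
    \<open>4\<close>, so \<open>|2 / c| \<le> 8\<close>.\<close>
  have "deriv (deriv k) 0 = deriv (deriv g) 0 + 2 / c"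
  proof (rule DERIV_imp_deriv)
    have "((\<lambda>z. c\<^sup>2 * deriv g z / (c - g z)\<^sup>2) has_field_derivative deriv (deriv g) 0 + 2 / c) (at 0)"
      using g c0 unfolding schlicht_def
      by (auto intro!: derivative_eq_intros g' simp: field_simps power2_eq_square)
    then show "(deriv k has_field_derivative deriv (deriv g) 0 + 2 / c) (at 0)"
      by (rule has_field_derivative_transform_within_open[of _ _ _ "ball 0 1"]) (auto simp: k')
  qed
  moreover have "norm (deriv (deriv k) 0) \<le> 4"
  proof (rule Bieberbach_second_coeff)
    show "k holomorphic_on ball 0 1"
      unfolding k_def using nz g by (auto intro!: holomorphic_intros simp: schlicht_def)
    show "inj_on k (ball 0 1)"
    proof (rule inj_onI)
      fix x y assume xy: "x \<in> ball 0 1" "y \<in> ball 0 1" "k x = k y"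
      then have "g x = g y"
        using nz[OF xy(1)] nz[OF xy(2)] c0 by (simp add: k_def field_simps)
      then show "x = y" using g xy by (auto simp: schlicht_def inj_on_def)
    qed
    show "k 0 = 0" "deriv k 0 = 1" using g c0 by (auto simp: k_def k' schlicht_def)
  qed
  moreover have "norm (deriv (deriv g) 0) \<le> 4"
    using g by (intro Bieberbach_second_coeff) (auto simp: schlicht_def)
  ultimately have "norm (2 / c) \<le> 8"
    using norm_triangle_ineq4[of "deriv (deriv k) 0" "deriv (deriv g) 0"] by simp
  then show ?thesis using c0 by (simp add: norm_divide field_simps)
qed

text \<open>Applies the coefficient bound to the normalization of \<open>g \<circ> T\<close>, \<open>T\<close> a disc automorphism with \<open>T 0 = w\<close>.\<close>

theorem schlicht_pre_Schwarzian_bound: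
  assumes g: "schlicht g" and w: "norm w < 1"
  shows "(1 - (norm w)\<^sup>2) * norm (deriv (deriv g) w) \<le> (4 + 2 * norm w) * norm (deriv g w)"
proof -
  define T where "T \<zeta> = Moebius_function 0 (- w) \<zeta>" for \<zeta>
  \<comment> \<open>\<open>m\<close> is the derivative of \<open>T\<close> at \<open>0\<close>, and
    \<open>d\<close> that of \<open>g \<circ> T\<close>.\<close>
  define m where "m = 1 - w * cnj w"
  define d where "d = m * deriv g w"
  have m_eq: "m = of_real (1 - (norm w)\<^sup>2)"
    by (simp add: m_def complex_norm_square flip: of_real_power)
  have pos: "1 - (norm w)\<^sup>2 > 0" using w by (simp add: abs_square_less_1)
  have m0: "m \<noteq> 0" using pos unfolding m_eq by (metis of_real_eq_0_iff less_irrefl)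
  have d0: "d \<noteq> 0" using schlicht_deriv_nonzero[OF g, of w] w m0 by (simp add: d_def)
  have T_eq: "T \<zeta> = (\<zeta> + w) / (1 + cnj w * \<zeta>)" for \<zeta>
    by (simp add: T_def Moebius_function_def)
  have Tb: "T \<zeta> \<in> ball 0 1" if "\<zeta> \<in> ball 0 1" for \<zeta>
    using Moebius_function_norm_lt_1[of "- w" \<zeta> 0] w that by (simp add: T_def)
  have Tinj: "inj_on T (ball 0 1)"
    using Moebius_function_compose[of w "- w"] w unfolding T_def
    by (intro inj_on_inverseI[of _ "Moebius_function 0 w"]) auto
  have nz: "1 + cnj w * \<zeta> \<noteq> 0" if "\<zeta> \<in> ball 0 1" for \<zeta>
  proof
    assume "1 + cnj w * \<zeta> = 0"
    then have "norm (cnj w * \<zeta>) = norm (-1 :: complex)" by (metis add_eq_0_iff)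
    then have "norm w * norm \<zeta> = 1" by (simp add: norm_mult)
    moreover have "norm w * norm \<zeta> < 1" using w that mult_strict_mono'[of "norm w" 1 "norm \<zeta>" 1] by simp
    ultimately show False by simp
  qed
  define F where "F \<zeta> = (g (T \<zeta>) - g w) / d" for \<zeta>
  have T': "(T has_field_derivative m / (1 + cnj w * \<zeta>)\<^sup>2) (at \<zeta>)" if "\<zeta> \<in> ball 0 1" for \<zeta>
    unfolding T_eq m_def using nz[OF that]
    by (auto intro!: derivative_eq_intros simp: field_simps power2_eq_square)
  have T0: "T 0 = w" by (simp add: T_eq)
  have F': "(F has_field_derivative deriv g (T \<zeta>) * (m / (1 + cnj w * \<zeta>)\<^sup>2) / d) (at \<zeta>)" if "\<zeta> \<in> ball 0 1" for \<zeta>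
  proof -
    have "((\<lambda>\<zeta>. g (T \<zeta>)) has_field_derivative deriv g (T \<zeta>) * (m / (1 + cnj w * \<zeta>)\<^sup>2)) (at \<zeta>)"
      by (rule DERIV_chain2[OF schlicht_has_field_derivative(1)[OF g Tb[OF that]] T'[OF that]])
    then show ?thesis unfolding F_def using d0 by (auto intro!: derivative_eq_intros)
  qed
  have "deriv (deriv F) 0 = (deriv (deriv g) w * m * m - 2 * cnj w * m * deriv g w) / d"
  proof (rule DERIV_imp_deriv)
    have z: "(0::complex) \<in> ball 0 1" by simp
    have "((\<lambda>\<zeta>. deriv g (T \<zeta>)) has_field_derivative deriv (deriv g) (T 0) * (m / (1 + cnj w * 0)\<^sup>2)) (at 0)"
      by (rule DERIV_chain2[OF schlicht_has_field_derivative(2)[OF g Tb[OF z]] T'[OF z]])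
    then have "((\<lambda>\<zeta>. deriv g (T \<zeta>) * (m / (1 + cnj w * \<zeta>)\<^sup>2) / d) has_field_derivative
        (deriv (deriv g) w * m * m - 2 * cnj w * m * deriv g w) / d) (at 0)"
      using d0 by (auto intro!: derivative_eq_intros simp: T0 field_simps)
    then show "(deriv F has_field_derivative (deriv (deriv g) w * m * m - 2 * cnj w * m * deriv g w) / d) (at 0)"
      by (rule has_field_derivative_transform_within_open[of _ _ _ "ball 0 1"])
         (auto simp: DERIV_imp_deriv[OF F'])
  qed
  also have "\<dots> = (m * deriv (deriv g) w - 2 * cnj w * deriv g w) / deriv g w"
    using d0 unfolding d_def by (simp add: field_simps)
  finally have eq: "deriv (deriv F) 0 = (m * deriv (deriv g) w - 2 * cnj w * deriv g w) / deriv g w" .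
  have "norm (deriv (deriv F) 0) \<le> 4"
  proof (rule Bieberbach_second_coeff)
    show "F holomorphic_on ball 0 1"
      using F' holomorphic_on_open[of "ball 0 1"] by blast
    show "inj_on F (ball 0 1)"
      using g Tb Tinj d0 unfolding inj_on_def F_def schlicht_def by (auto simp: inj_on_def)
    show "F 0 = 0" by (simp add: F_def T0)
    show "deriv F 0 = 1" using DERIV_imp_deriv[OF F', of 0] d0 by (simp add: T0 d_def)
  qed
  then have "norm (m * deriv (deriv g) w - 2 * cnj w * deriv g w) \<le> 4 * norm (deriv g w)"
    using d0 unfolding eq by (simp add: norm_divide d_def field_simps)
  moreover have "norm (m * deriv (deriv g) w) - norm (2 * cnj w * deriv g w)
      \<le> norm (m * deriv (deriv g) w - 2 * cnj w * deriv g w)"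
    by (rule norm_triangle_ineq2)
  moreover have "norm m = 1 - (norm w)\<^sup>2" using pos unfolding m_eq norm_of_real by simp
  ultimately show ?thesis by (simp add: norm_mult algebra_simps)
qed

section \<open>Integration along radii: distortion, growth and the Newton residual\<close>

text \<open>The mean value inequality on the radius from \<open>0\<close> to \<open>w\<close>, along
  which \<open>f\<close> moves with speed at most \<open>\<Phi>'\<close>. It integrates derivative
  bounds that depend only on the modulus.\<close>

lemma radial_growth_bound:
  fixes f :: "complex \<Rightarrow> complex" and \<Phi> :: "real \<Rightarrow> real"
  assumes f: "\<And>z. norm z < R \<Longrightarrow> (f has_field_derivative f' z) (at z)"
    and \<Phi>: "\<And>t. 0 \<le> t \<Longrightarrow> t < R \<Longrightarrow> (\<Phi> has_field_derivative \<Phi>' t) (at t)"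
    and bnd: "\<And>z. norm z < R \<Longrightarrow> norm (f' z) \<le> \<Phi>' (norm z)" and w: "norm w < R"
  shows "norm (f w - f 0) \<le> \<Phi> (norm w) - \<Phi> 0"
proof (cases "w = 0")
  case False
  define e where "e = sgn w"
  have e: "norm e = 1" using False by (simp add: e_def norm_sgn)
  have we: "w = of_real (norm w) * e" by (simp add: e_def sgn_div_norm scaleR_conv_of_real False)
  have line: "((\<lambda>t. f (of_real t * e)) has_vector_derivative f' (of_real t * e) * e) (at t)"
    if "0 \<le> t" "t < R" for t
    using that e f[of "of_real t * e"]
    by (auto intro!: has_vector_derivative_real_field DERIV_chain2[of f] derivative_eq_intros
        simp: norm_mult field_vector_diff_chain_at)
  have \<Phi>': "(\<Phi> has_vector_derivative \<Phi>' t) (at t)" if "0 \<le> t" "t < R" for t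
    using \<Phi>[OF that] by (simp add: has_real_derivative_iff_has_vector_derivative)
  have "norm (f (of_real (norm w) * e) - f (of_real 0 * e)) \<le> \<Phi> (norm w) - \<Phi> 0"
  proof (rule differentiable_bound_general)
    show "0 < norm w" using False by simp
    show "continuous_on {0..norm w} (\<lambda>t. f (of_real t * e))"
      using line[THEN has_vector_derivative_continuous] w
      by (intro continuous_at_imp_continuous_on) force
    show "continuous_on {0..norm w} \<Phi>"
      using \<Phi>'[THEN has_vector_derivative_continuous] w
      by (intro continuous_at_imp_continuous_on) force
  next
    fix t assume t: "0 < t" "t < norm w"
    show "((\<lambda>t. f (of_real t * e)) has_vector_derivative f' (of_real t * e) * e) (at t)"
      "(\<Phi> has_vector_derivative \<Phi>' t) (at t)"
      using t w line \<Phi>' by auto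
    show "norm (f' (of_real t * e) * e) \<le> \<Phi>' t"
      using bnd[of "of_real t * e"] t w e by (simp add: norm_mult)
  qed
  then show ?thesis using we by simp
qed auto

text \<open>The witness is the branch of \<open>log g'\<close> vanishing at \<open>0\<close>. Its
  derivative \<open>g'' / g'\<close> is at most
  \<open>(4 + 2 * t) / (1 - t^2) = 1 / (1 + t) + 3 / (1 - t)\<close> at modulus \<open>t\<close>,
  which integrates to these logarithms.\<close>

lemma schlicht_log_deriv_bound:
  assumes g: "schlicht g"
  obtains L where "\<And>w. norm w < 1 \<Longrightarrow> deriv g w = exp (L w)"
    and "\<And>w. norm w < 1 \<Longrightarrow> norm (L w) \<le> ln (1 + norm w) - 3 * ln (1 - norm w)"
proof -
  have hol: "deriv g holomorphic_on ball 0 1"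
    using g by (auto simp: schlicht_def intro!: holomorphic_deriv)
  obtain L where L: "L holomorphic_on ball 0 1" "\<And>z. z \<in> ball 0 1 \<Longrightarrow> deriv g z = exp (L z)"
    using contractible_imp_holomorphic_log[OF hol convex_imp_contractible[OF convex_ball]]
      schlicht_deriv_nonzero[OF g] by blast
  have L': "(L has_field_derivative deriv (deriv g) z / deriv g z) (at z)" if z: "z \<in> ball 0 1" for z
  proof -
    have dL: "(L has_field_derivative deriv L z) (at z)" by (rule holomorphic_derivI[OF L(1) _ z]) auto
    then have "((\<lambda>z. exp (L z)) has_field_derivative exp (L z) * deriv L z) (at z)"
      by (auto intro!: derivative_eq_intros)
    then have "(deriv g has_field_derivative exp (L z) * deriv L z) (at z)"
      by (rule has_field_derivative_transform_within_open[of _ _ _ "ball 0 1"]) (use z L(2) in auto)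
    then have "deriv (deriv g) z = exp (L z) * deriv L z" by (rule DERIV_imp_deriv)
    then show ?thesis using dL L(2)[OF z] by simp
  qed
  have bound: "norm (L w - L 0) \<le> (ln (1 + norm w) - 3 * ln (1 - norm w)) - (ln (1 + 0) - 3 * ln (1 - 0))"
    if "norm w < 1" for w
  proof (rule radial_growth_bound[where R = 1 and \<Phi> = "\<lambda>t. ln (1 + t) - 3 * ln (1 - t)" and
      f' = "\<lambda>z. deriv (deriv g) z / deriv g z" and \<Phi>' = "\<lambda>t. (4 + 2 * t) / (1 - t\<^sup>2)"])
    fix t :: real assume t: "0 \<le> t" "t < 1"
    have "(4 + 2 * t) / (1 - t\<^sup>2) = 1 / (1 + t) + 3 / (1 - t)"
    proof -
      have "1 - t\<^sup>2 = (1 + t) * (1 - t)" by (simp add: power2_eq_square algebra_simps)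
      then show ?thesis using t by (simp add: divide_simps)
    qed
    then show "((\<lambda>t. ln (1 + t) - 3 * ln (1 - t)) has_field_derivative (4 + 2 * t) / (1 - t\<^sup>2)) (at t)"
      using t by (auto intro!: derivative_eq_intros)
  next
    fix z :: complex assume z: "norm z < 1"
    have "1 - (norm z)\<^sup>2 > 0" using z by (simp add: abs_square_less_1)
    then show "norm (deriv (deriv g) z / deriv g z) \<le> (4 + 2 * norm z) / (1 - (norm z)\<^sup>2)"
      using schlicht_pre_Schwarzian_bound[OF g z] schlicht_deriv_nonzero[OF g, of z] z
      by (simp add: norm_divide field_simps)
  qed (use that L' in auto)
  have "exp (L 0) = 1" using L(2)[of 0] g by (simp add: schlicht_def)
  then show ?thesis
    using bound L(2) by (intro that[of "\<lambda>z. L z - L 0"]) (auto simp: exp_diff)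
qed

text \<open>Since \<open>|g'| = exp (Re L)\<close> and \<open>|Re L| \<le> |L|\<close>, the single
  bound on \<open>|L|\<close> yields both estimates.\<close>

theorem schlicht_distortion:
  assumes g: "schlicht g" and w: "norm w < 1"
  shows "norm (deriv g w) \<le> (1 + norm w) / (1 - norm w) ^ 3"
    and "(1 - norm w) ^ 3 / (1 + norm w) \<le> norm (deriv g w)"
proof -
  obtain L where L: "\<And>w. norm w < 1 \<Longrightarrow> deriv g w = exp (L w)"
    "\<And>w. norm w < 1 \<Longrightarrow> norm (L w) \<le> ln (1 + norm w) - 3 * ln (1 - norm w)"
    using schlicht_log_deriv_bound[OF g] by blast
  define B where "B = ln (1 + norm w) - 3 * ln (1 - norm w)"
  have "exp (3 * ln (1 - norm w)) = (1 - norm w) ^ 3"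
    using w exp_of_nat_mult[of 3 "ln (1 - norm w)"] by simp
  moreover have "exp (ln (1 + norm w)) = 1 + norm w" using norm_ge_zero[of w] by (intro exp_ln) linarith
  ultimately have B: "exp B = (1 + norm w) / (1 - norm w) ^ 3" "exp (- B) = (1 - norm w) ^ 3 / (1 + norm w)"
    unfolding B_def by (simp_all add: exp_diff)
  have "\<bar>Re (L w)\<bar> \<le> B" using abs_Re_le_cmod[of "L w"] L(2)[OF w] by (simp add: B_def)
  then have "exp (Re (L w)) \<le> exp B" "exp (- B) \<le> exp (Re (L w))" by auto
  then show "norm (deriv g w) \<le> (1 + norm w) / (1 - norm w) ^ 3"
    "(1 - norm w) ^ 3 / (1 + norm w) \<le> norm (deriv g w)"
    unfolding B L(1)[OF w] norm_exp_eq_Re .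
qed

text \<open>The Koebe function \<open>t / (1 - t)^2\<close> is a primitive of the upper distortion
  bound.\<close>

theorem schlicht_growth:
  assumes g: "schlicht g" and w: "norm w < 1"
  shows "norm (g w) \<le> norm w / (1 - norm w)\<^sup>2"
proof -
  have "norm (g w - g 0) \<le> norm w / (1 - norm w)\<^sup>2 - 0 / (1 - 0)\<^sup>2"
  proof (rule radial_growth_bound[where R = 1 and \<Phi> = "\<lambda>t. t / (1 - t)\<^sup>2" and f' = "deriv g" and
       \<Phi>' = "\<lambda>t. (1 + t) / (1 - t) ^ 3"])
    fix t :: real assume t: "0 \<le> t" "t < 1"
    show "((\<lambda>t. t / (1 - t)\<^sup>2) has_field_derivative (1 + t) / (1 - t) ^ 3) (at t)"
      using t by (auto intro!: derivative_eq_intros simp: divide_simps eval_nat_numeral) (simp add: algebra_simps)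
  qed (use w schlicht_has_field_derivative[OF g] schlicht_distortion(1)[OF g] in auto)
  then show ?thesis using g by (simp add: schlicht_def)
qed

text \<open>The left side is the modulus of the Newton map of the inverse at \<open>g w\<close>. Its
  radial speed is controlled by \<open>|w g'' w|\<close>: multiplying the bound on
  \<open>g'' / g'\<close> by the distortion bound and cancelling \<open>1 + t\<close> gives
  \<open>\<Phi>'\<close>.\<close>

lemma schlicht_newton_residual_bound:
  assumes g: "schlicht g" and w: "norm w < 1"
  shows "norm (g w - w * deriv g w) \<le> 2 * (norm w)\<^sup>2 / (1 - norm w) ^ 3"
proof -
  have "norm ((g w - w * deriv g w) - (g 0 - 0 * deriv g 0)) \<le> 2 * (norm w)\<^sup>2 / (1 - norm w) ^ 3 - 2 * 0\<^sup>2 / (1 - 0) ^ 3"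
  proof (rule radial_growth_bound[where R = 1 and \<Phi> = "\<lambda>t. 2 * t\<^sup>2 / (1 - t) ^ 3" and
       f = "\<lambda>z. g z - z * deriv g z" and
       f' = "\<lambda>z. - z * deriv (deriv g) z" and \<Phi>' = "\<lambda>t. t * (4 + 2 * t) / (1 - t) ^ 4"])
    fix t :: real assume t: "0 \<le> t" "t < 1"
    show "((\<lambda>t. 2 * t\<^sup>2 / (1 - t) ^ 3) has_field_derivative t * (4 + 2 * t) / (1 - t) ^ 4) (at t)"
      using t by (auto intro!: derivative_eq_intros simp: divide_simps eval_nat_numeral) (simp add: algebra_simps)
  next
    fix z :: complex assume z: "norm z < 1"
    show "((\<lambda>z. g z - z * deriv g z) has_field_derivative - z * deriv (deriv g) z) (at z)"
      using z schlicht_has_field_derivative[OF g, of z] by (auto intro!: derivative_eq_intros)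
    define t where "t = norm z"
    have t: "0 \<le> t" "t < 1" using z by (auto simp: t_def)
    have sq: "1 - t\<^sup>2 = (1 + t) * (1 - t)" by (simp add: power2_eq_square algebra_simps)
    have "(1 - t\<^sup>2) * norm (deriv (deriv g) z) \<le> (4 + 2 * t) * ((1 + t) / (1 - t) ^ 3)"
      using schlicht_pre_Schwarzian_bound[OF g z] schlicht_distortion(1)[OF g z] t
        mult_left_mono[of "norm (deriv g z)" "(1 + t) / (1 - t) ^ 3" "4 + 2 * t"]
      unfolding t_def by linarith
    then have "(1 + t) * ((1 - t) * norm (deriv (deriv g) z)) \<le> (1 + t) * ((4 + 2 * t) / (1 - t) ^ 3)"
      by (simp add: sq mult_ac)
    then have "(1 - t) * norm (deriv (deriv g) z) \<le> (4 + 2 * t) / (1 - t) ^ 3"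
      using t by (simp only: mult_le_cancel_left)
    then have "norm (deriv (deriv g) z) \<le> (4 + 2 * t) / (1 - t) ^ 4"
      using t pos_le_divide_eq[of "1 - t" "norm (deriv (deriv g) z)" "(4 + 2 * t) / (1 - t) ^ 3"]
      by (simp add: mult.commute power4_eq_xxxx power3_eq_cube)
    then have "t * norm (deriv (deriv g) z) \<le> t * ((4 + 2 * t) / (1 - t) ^ 4)"
      using t by (intro mult_left_mono) auto
    then show "norm (- z * deriv (deriv g) z) \<le> norm z * (4 + 2 * norm z) / (1 - norm z) ^ 4"
      by (simp add: norm_mult t_def)
  qed (use w in auto)
  then show ?thesis using g by (simp add: schlicht_def)
qed

section \<open>The inverse function and its Newton map\<close>

lemma schlicht_inverse:
  assumes g: "schlicht g" and f: "f = the_inv_into (ball 0 1) g" and z: "z \<in> g ` ball 0 1"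
  shows "f z \<in> ball 0 1" "g (f z) = z"
    "(f has_field_derivative 1 / deriv g (f z)) (at z)"
proof -
  have g': "g holomorphic_on ball 0 1" "inj_on g (ball 0 1)" using g by (auto simp: schlicht_def)
  have fg: "f (g w) = w" if "w \<in> ball 0 1" for w
    using the_inv_into_f_f[OF g'(2) that] by (simp add: f)
  obtain w where w: "w \<in> ball 0 1" "z = g w" using z by blast
  show "f z \<in> ball 0 1" "g (f z) = z" using w fg by auto
  have "(f has_field_derivative inverse (deriv g w)) (at (g w))"
    by (rule has_field_derivative_inverse_strong[OF _ _ open_ball w(1)])
       (use w fg g' schlicht_deriv_nonzero[OF g] schlicht_has_field_derivative[OF g] in
         \<open>auto intro: holomorphic_on_imp_continuous_on\<close>)
  then show "(f has_field_derivative 1 / deriv g (f z)) (at z)"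
    using w fg by (simp add: inverse_eq_divide)
qed

text \<open>Weakens the sharp bound by \<open>1 / (1 + t) \<ge> 1 - t\<close>, so that its primitive
  is a polynomial.\<close>

lemma schlicht_deriv_ge_power:
  assumes g: "schlicht g" and w: "norm w < 1"
  shows "(1 - norm w) ^ 4 \<le> norm (deriv g w)"
proof -
  have "(1 - norm w) * (1 + norm w) \<le> 1" by (simp add: algebra_simps)
  then have "1 - norm w \<le> 1 / (1 + norm w)"
    using norm_ge_zero[of w] by (intro mult_imp_le_div_pos) linarith+
  then have "(1 - norm w) ^ 3 * (1 - norm w) \<le> (1 - norm w) ^ 3 * (1 / (1 + norm w))"
    using w by (intro mult_left_mono) auto
  also have "\<dots> = (1 - norm w) ^ 3 / (1 + norm w)" by simp
  also have "\<dots> \<le> norm (deriv g w)" by (rule schlicht_distortion(2)[OF g w])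
  finally show ?thesis by (simp add: power3_eq_cube power4_eq_xxxx)
qed

text \<open>
  Integrates \<open>(1 - |f|)^4 |f'| \<le> 1\<close> along the segment from \<open>0\<close> to \<open>z\<close>, which lies in the image of \<open>g\<close> by
  Koebe's quarter theorem.
\<close>

lemma schlicht_inverse_growth:
  assumes g: "schlicht g" and f: "f = the_inv_into (ball 0 1) g" and z: "norm z < 1/4"
  shows "1 - (1 - norm (f z)) ^ 5 \<le> 5 * norm z"
proof (cases "z = 0")
  case False
  have img: "x \<in> g ` ball 0 1" if "norm x < 1/4" for x
    using Koebe_quarter[OF g, of x] that by force
  define e where "e = sgn z"
  have e: "norm e = 1" using False by (simp add: e_def norm_sgn)
  have ze: "z = of_real (norm z) * e" by (simp add: e_def sgn_div_norm scaleR_conv_of_real False)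
  define p where "p s = f (of_real s * e)" for s
  have inside: "of_real s * e \<in> g ` ball 0 1" if "0 \<le> s" "s \<le> norm z" for s :: real
    using that z e by (intro img) (simp add: norm_mult)
  have p': "(p has_vector_derivative 1 / deriv g (p s) * e) (at s)" if "0 \<le> s" "s \<le> norm z" for s
  proof -
    have "((\<lambda>t. of_real t * e) has_vector_derivative e) (at s)"
      by (auto intro!: derivative_eq_intros)
    from field_vector_diff_chain_at[OF this schlicht_inverse(3)[OF g f inside[OF that]]]
    show ?thesis by (simp add: p_def[abs_def] o_def mult.commute)
  qed
  have p0: "p 0 = 0"
    using g the_inv_into_f_f[of g "ball 0 1" 0] by (simp add: p_def f schlicht_def)
  have pnz: "p s \<noteq> 0" if "0 < s" "s \<le> norm z" for s
    using schlicht_inverse(2)[OF g f inside[of s]] that e g by (auto simp: p_def schlicht_def)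
  have plt: "norm (p s) < 1" if "0 \<le> s" "s \<le> norm z" for s
    using schlicht_inverse(1)[OF g f inside[OF that]] by (simp add: p_def)
  \<comment> \<open>\<open>u\<close> is the slack in the claim along the segment. It does not
    decrease because \<open>|p|\<close> grows at rate at most
    \<open>|f'| \<le> 1 / (1 - |p|)^4\<close>.\<close>
  define u where "u s = 5 * s - (1 - (1 - norm (p s)) ^ 5)" for s
  have "u 0 \<le> u (norm z)"
  \<comment> \<open>Derivatives are taken on the open interval only: at \<open>0\<close> the curve
    \<open>p\<close> vanishes, where the norm is not differentiable.\<close>
  proof (rule DERIV_nonneg_imp_increasing_open[of 0 "norm z" u])
    show "continuous_on {0..norm z} u"
      unfolding u_def using p'[THEN has_vector_derivative_continuous]
      by (intro continuous_intros continuous_at_imp_continuous_on) force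
  next
    fix s assume s: "0 < s" "s < norm z"
    define D where "D = 1 / deriv g (p s) * e"
    have "((\<lambda>s. norm (p s)) has_derivative (\<lambda>h. inner (h *\<^sub>R D) (sgn (p s)))) (at s)"
    proof (rule has_derivative_compose[where f = p and g = norm and f' = "\<lambda>h. h *\<^sub>R D"
          and g' = "\<lambda>h. inner h (sgn (p s))"])
      show "(p has_derivative (\<lambda>h. h *\<^sub>R D)) (at s)"
        using p'[of s] s by (simp add: has_vector_derivative_def D_def)
      show "(norm has_derivative (\<lambda>h. inner h (sgn (p s)))) (at (p s))"
        using pnz[of s] s by (intro has_derivative_norm) auto
    qed
    then have n': "((\<lambda>s. norm (p s)) has_field_derivative inner D (sgn (p s))) (at s)"
      by (simp add: has_field_derivative_def mult.commute[of _ "inner D (sgn (p s))"])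
    have "inner D (sgn (p s)) \<le> norm D * norm (sgn (p s))" by (rule norm_cauchy_schwarz)
    also have "\<dots> = 1 / norm (deriv g (p s))" using s pnz[of s] e by (simp add: D_def norm_mult norm_divide norm_sgn)
    also have "\<dots> \<le> 1 / (1 - norm (p s)) ^ 4"
      using schlicht_deriv_ge_power[OF g plt[of s]] plt[of s] s by (intro frac_le) auto
    finally have "(1 - norm (p s)) ^ 4 * inner D (sgn (p s)) \<le> 1"
      using plt[of s] s by (simp add: field_simps)
    moreover have "(u has_field_derivative 5 - 5 * ((1 - norm (p s)) ^ 4 * inner D (sgn (p s)))) (at s)"
      unfolding u_def by (auto intro!: derivative_eq_intros n')
    ultimately show "\<exists>y. (u has_field_derivative y) (at s) \<and> 0 \<le> y" by force
  qed auto
  then show ?thesis using ze by (simp add: u_def p0) (simp add: p_def)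
next
  case True
  have "f 0 = 0" using g the_inv_into_f_f[of g "ball 0 1" 0] by (simp add: f schlicht_def)
  then show ?thesis by (simp add: True)
qed

section \<open>Explicit constants and quadratic convergence\<close>

text \<open>If \<open>v > 3/20\<close>, then \<open>1 - (17/20)^5 > 0.556\<close> would be at most
  \<open>5 * |z| < 0.553\<close>. For \<open>v \<le> 3/20\<close> one has
  \<open>1 - (1 - v)^5 \<ge> 5 * v - 10 * v^2 \<ge> 7/2 * v\<close>, whence the factor
  \<open>10/7\<close>.\<close>

lemma schlicht_inverse_linear_bound:
  assumes g: "schlicht g" and f: "f = the_inv_into (ball 0 1) g" and z: "norm z < 110549/1000000"
  shows "norm (f z) \<le> 3/20" and "norm (f z) \<le> 10/7 * norm z"
proof -
  define v where "v = norm (f z)"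
  have b: "1 - (1 - v) ^ 5 \<le> 5 * norm z" unfolding v_def using z by (intro schlicht_inverse_growth[OF g f]) simp
  have "z \<in> g ` ball 0 1" using Koebe_quarter[OF g, of z] z by force
  then have v: "0 \<le> v" "v < 1" using schlicht_inverse(1)[OF g f] by (auto simp: v_def)
  have v15: "v \<le> 3/20"
  proof (rule ccontr)
    assume "\<not> v \<le> 3/20"
    then have "(1 - v) ^ 5 \<le> (17/20) ^ 5" using v by (intro power_mono) auto
    then show False using b z by (simp add: power_divide)
  qed
  then show "norm (f z) \<le> 3/20" by (simp add: v_def)
  have "1 - (1 - v) ^ 5 = 5 * v - 10 * v\<^sup>2 + v\<^sup>2 * (v * (10 - 5 * v) + v\<^sup>2 * v)"
    by (simp add: eval_nat_numeral algebra_simps)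
  moreover have "0 \<le> v\<^sup>2 * (v * (10 - 5 * v) + v\<^sup>2 * v)" using v by simp
  moreover have "v\<^sup>2 \<le> 3/20 * v" using v v15 unfolding power2_eq_square by (intro mult_right_mono) auto
  ultimately have "7/2 * v \<le> 5 * norm z" using b by linarith
  then show "norm (f z) \<le> 10/7 * norm z" by (simp add: v_def)
qed

text \<open>With \<open>w = f z\<close> the Newton map is \<open>g w - w g' w\<close>, as
  \<open>f' z = 1 / g' w\<close>. The residual bound then gives the constant
  \<open>2 * (10/7)^2 / (17/20)^3 < 6.65\<close>.\<close>

lemma newton_map_schlicht_inverse_bound:
  assumes g: "schlicht g" and f: "f = the_inv_into (ball 0 1) g" and z: "norm z < 110549/1000000"
  shows "z \<in> g ` ball 0 1" and "norm (newton_map f z) \<le> 67/10 * (norm z)\<^sup>2"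
proof -
  show img: "z \<in> g ` ball 0 1" using Koebe_quarter[OF g, of z] z by force
  define v where "v = norm (f z)"
  have v: "0 \<le> v" "v \<le> 3/20" "v \<le> 10/7 * norm z"
    using schlicht_inverse_linear_bound[OF g f z] by (auto simp: v_def)
  have "newton_map f z = g (f z) - f z * deriv g (f z)"
    using schlicht_inverse(2)[OF g f img] DERIV_imp_deriv[OF schlicht_inverse(3)[OF g f img]]
    by (simp add: newton_map_def)
  then have "norm (newton_map f z) \<le> 2 * v\<^sup>2 / (1 - v) ^ 3"
    using schlicht_newton_residual_bound[OF g, of "f z"] v unfolding v_def by simp
  also have "\<dots> \<le> 2 * (10/7 * norm z)\<^sup>2 / (17/20) ^ 3"
    using v by (intro frac_le mult_left_mono power_mono) auto
  also have "\<dots> \<le> 67/10 * (norm z)\<^sup>2"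
    by (simp add: power_mult_distrib power_divide) 
  finally show "norm (newton_map f z) \<le> 67/10 * (norm z)\<^sup>2" .
qed

text \<open>The scaled modulus \<open>67/10 * |z|\<close> is sent to at most its square and starts
  below \<open>0.741 < 3/4\<close>. Being below \<open>1\<close>, it forces the iterates to stay in
  the disc, where the quadratic estimate applies again.\<close>

lemma newton_iterates_schlicht_inverse:
  assumes g: "schlicht g" and f: "f = the_inv_into (ball 0 1) g" and z: "norm z < 110549/1000000"
  shows "norm ((newton_map f ^^ k) z) < 110549/1000000" and "67/10 * norm ((newton_map f ^^ k) z) \<le> (3/4) ^ (2 ^ k)"
proof -
  have "norm ((newton_map f ^^ k) z) < 110549/1000000 \<and> 67/10 * norm ((newton_map f ^^ k) z) \<le> (3/4) ^ (2 ^ k)"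
  proof (induction k)
    case 0
    then show ?case using z by simp
  next
    case (Suc k)
    define y where "y = norm ((newton_map f ^^ k) z)"
    have y: "0 \<le> y" "y < 110549/1000000" "67/10 * y \<le> (3/4) ^ (2 ^ k)" using Suc by (auto simp: y_def)
    have N: "norm ((newton_map f ^^ Suc k) z) \<le> 67/10 * y\<^sup>2"
      using newton_map_schlicht_inverse_bound(2)[OF g f, of "(newton_map f ^^ k) z"] y(2) by (simp add: y_def)
    have "y\<^sup>2 \<le> (110549/1000000) * y" using y unfolding power2_eq_square by (intro mult_right_mono) auto
    then have "norm ((newton_map f ^^ Suc k) z) < 110549/1000000" using N y by linarith
    moreover have "(67/10 * y)\<^sup>2 \<le> ((3/4) ^ (2 ^ k))\<^sup>2" using y by (intro power_mono) auto
    then have "67/10 * (67/10 * y\<^sup>2) \<le> (3/4) ^ (2 ^ Suc k)"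
      by (simp add: power_mult_distrib power2_eq_square power_add mult_2)
    ultimately show ?case using N by simp
  qed
  then show "norm ((newton_map f ^^ k) z) < 110549/1000000" "67/10 * norm ((newton_map f ^^ k) z) \<le> (3/4) ^ (2 ^ k)" by auto
qed

text \<open>The summand \<open>3\<close> provides the exponent \<open>2^3 = 8\<close>, and
  \<open>(3/4)^8 < 1/2\<close>. With \<open>k = m + 3\<close> the hypothesis reads
  \<open>|log 2 \<epsilon>| \<le> 2^m\<close>, that is
  \<open>(1/2)^(2^m) \<le> \<epsilon>\<close>.\<close>

lemma three_quarters_iterated_square_le:
  fixes \<epsilon> :: real
  assumes \<epsilon>: "0 < \<epsilon>" "\<epsilon> < 1/8" and k: "3 + log 2 \<bar>log 2 \<epsilon>\<bar> \<le> real k"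
  shows "(3/4) ^ (2 ^ k) \<le> \<epsilon>"
proof -
  have "log 2 \<epsilon> < log 2 (2 powr (-3))"
    using \<epsilon> by (intro log_less) (auto simp: powr_minus powr_numeral)
  then have l: "log 2 \<epsilon> < -3" by simp
  \<comment> \<open>\<open>|log 2 \<epsilon>| > 3\<close> makes the outer logarithm positive, so the
    natural number subtraction \<open>k - 3\<close> does not truncate.\<close>
  then have "0 < log 2 \<bar>log 2 \<epsilon>\<bar>" by simp
  then have "3 \<le> k" using k by linarith
  define m where "m = k - 3"
  have m: "k = m + 3" using \<open>3 \<le> k\<close> by (simp add: m_def)
  have "\<bar>log 2 \<epsilon>\<bar> \<le> 2 powr real m"
    using k l by (simp add: m log_le_iff)
  then have "- real (2 ^ m) \<le> log 2 \<epsilon>" using l by (simp add: powr_realpow)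
  then have "2 powr (- real (2 ^ m)) \<le> \<epsilon>" using \<epsilon> by (simp add: le_log_iff)
  moreover have "2 powr (- real (2 ^ m)) = (1/2) ^ (2 ^ m)"
    by (simp only: powr_minus powr_realpow) (simp add: power_one_over inverse_eq_divide)
  moreover have "(3/4 :: real) ^ (2 ^ k) = ((3/4) ^ 8) ^ (2 ^ m)"
    by (simp add: m power_add mult.commute flip: power_mult)
  moreover have "((3/4 :: real) ^ 8) ^ (2 ^ m) \<le> (1/2) ^ (2 ^ m)"
    by (intro power_mono) (simp_all add: power_divide)
  ultimately show ?thesis by linarith
qed

theorem corollary23:
  "\<exists>\<rho>\<^sub>2 \<beta>\<^sub>2 :: real.
     \<bar>\<rho>\<^sub>2 - 0.110549\<bar> < 0.0000005 \<and> \<bar>\<beta>\<^sub>2 - 0.091287\<bar> < 0.0000005 \<and>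
     (\<forall>(g :: complex \<Rightarrow> complex) f.
        g holomorphic_on ball 0 1 \<longrightarrow> inj_on g (ball 0 1) \<longrightarrow> g 0 = 0 \<longrightarrow> deriv g 0 = 1 \<longrightarrow>
        f = the_inv_into (ball 0 1) g \<longrightarrow>
        g ` ball 0 \<beta>\<^sub>2 \<subseteq> ball 0 \<rho>\<^sub>2 \<and>
        (\<forall>z \<in> ball 0 \<rho>\<^sub>2.
           (\<forall>(\<epsilon>::real) (k::nat).
              0 < \<epsilon> \<longrightarrow> \<epsilon> < 1/8 \<longrightarrow> real k \<ge> 3 + log 2 \<bar>log 2 \<epsilon>\<bar> \<longrightarrow>
              newton_iterate_defined (g ` ball 0 1) f k z \<and>
              (newton_map f ^^ k) z \<in> ball 0 \<epsilon>) \<and>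
           (\<forall>\<epsilon>::real. \<epsilon> > 1/8 \<longrightarrow> z \<in> ball 0 \<epsilon>)))"
proof (rule exI[of _ "110549/1000000 :: real"], rule exI[of _ "912868/10000000 :: real"], intro conjI allI impI ballI)
  fix g :: "complex \<Rightarrow> complex" and f
  assume "g holomorphic_on ball 0 1" "inj_on g (ball 0 1)" "g 0 = 0" "deriv g 0 = 1"
    and f: "f = the_inv_into (ball 0 1) g"
  then have g: "schlicht g" by (simp add: schlicht_def)
  \<comment> \<open>The radius is \<open>0.0912868\<close>, not \<open>0.091287\<close>: at the
    latter \<open>t / (1 - t)^2\<close> already exceeds \<open>0.110549\<close>.\<close>
  show "g ` ball 0 (912868/10000000) \<subseteq> ball 0 (110549/1000000)"
  proof clarsimp
    fix w :: complex assume w: "norm w * 2500000 < 228217"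
    then have w: "norm w < 912868/10000000" by simp
    have "norm (g w) \<le> norm w / (1 - norm w)\<^sup>2" using w by (intro schlicht_growth[OF g]) simp
    also have "\<dots> < 912868/10000000 / (1 - 912868/10000000)\<^sup>2"
      using w by (intro frac_less power_mono) auto
    also have "\<dots> \<le> 110549/1000000" by (simp add: power2_eq_square)
    finally show "norm (g w) * 1000000 < 110549" by simp
  qed
  fix z :: complex assume "z \<in> ball 0 (110549/1000000)"
  then have z: "norm z < 110549/1000000" by simp
  note it = newton_iterates_schlicht_inverse[OF g f z]
  \<comment> \<open>Holds because \<open>0.110549 < 1/8\<close>.\<close>
  show "z \<in> ball 0 \<epsilon>" if "1/8 < \<epsilon>" for \<epsilon> using z that by simp
  fix \<epsilon> :: real and k :: nat
  assume \<epsilon>: "0 < \<epsilon>" "\<epsilon> < 1/8" and k: "3 + log 2 \<bar>log 2 \<epsilon>\<bar> \<le> real k"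
  show "newton_iterate_defined (g ` ball 0 1) f k z"
    unfolding newton_iterate_defined_def
    using newton_map_schlicht_inverse_bound(1)[OF g f it(1)] by blast
  have "67/10 * norm ((newton_map f ^^ k) z) \<le> \<epsilon>"
    using it(2)[of k] three_quarters_iterated_square_le[OF \<epsilon> k] by linarith
  \<comment> \<open>The factor \<open>67/10 > 1\<close> and \<open>\<epsilon> > 0\<close> make the
    inequality strict.\<close>
  then show "(newton_map f ^^ k) z \<in> ball 0 \<epsilon>"
    using \<epsilon> norm_ge_zero[of "(newton_map f ^^ k) z"] unfolding mem_ball_0 by linarith
qed simp_all

end
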